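(* Any minimal $S$-adic subshift with bounded alphabet rank is topologically conjugate to a subshift of finite topological rank.
   Context: Words and morphisms. For a finite alphabet $A$, $A^*$ is the set of finite words over $A$ (including the empty word). A directive sequence is a sequence $\tau=(\tau_n:A_{n+1}\to A_n^* )_{n\ge0}$ where the $A_n$ are finite alphabets and $\tau_n(a)$ is not the empty word for all $a\in A_{n+1}$; each $\tau_n$ extends to $A_{n+1}^*$ by concatenation. For $n<N$ put $\tau_{[n,N)}=\tau_n\circ\tau_{n+1}\circ\cdots\circ\tau_{N-1}$. For a morphism $\rho:A\to B^*$, $M_\rho$ is the $|A|\times|B|$ matrix whose $(a,b)$ entry is the number of occurrences of $b$ in $\rho(a)$. $\tau$ is primitive if for every $n\ge1$ there is $N\ge n$ with all entries of $M_{\tau_{[n,N)}}$ positive. $S$-adic subshifts. For $n\ge0$, $\mathcal L^{(n)}(\tau)$ is the set of words $w\in A_n^*$ that occur as a subword of $\tau_{[n,N)}(a)$ for some $N>n$ and $a\in A_N$, and $X_\tau^{(n)}$ is the set of $x\in A_n^{\mathbb Z}$ all of whose finite factors belong to $\mathcal L^{(n)}(\tau)$; with the shift $\sigma$ it is a subshift, minimal if $\tau$ is primitive. The minimal $S$-adic subshift generated by a primitive directive sequence $\tau$ is $(X_\tau^{(0)},\sigma)$ (systems are nonempty by convention). It has bounded alphabet rank if it is generated by such a $\tau$ with $\liminf_{n\to\infty}|A_n|<\infty$ (equivalently, after composing consecutive morphisms, with $\sup_n|A_n|<\infty$). Topological rank. Let $X$ be a compact totally disconnected metrizable space and $(X,T)$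 minimal. A Kakutani-Rokhlin partition is a finite partition of $X$ into nonempty clopen sets of the form $\{T^{j}B_{i} : 1\le i\le k,\ 0\le j<h_i\}$; for each $i$ the family $\{T^jB_i:0\le j<h_i\}$ is called a tower, and $\bigcup_{i=1}^k B_i$ is the base. The system has finite topological rank if there is a sequence $(\mathcal T_n)_{n\ge1}$ of Kakutani-Rokhlin partitions such that $\mathcal T_{n+1}$ refines $\mathcal T_n$, the bases are decreasing with intersection a single point, $\bigcup_n\mathcal T_n$ generates the topology of $X$, and the number of towers of $\mathcal T_n$ is bounded uniformly in $n$. *)

theory Defs
  imports
    "HOL-Analysis.Analysis"
    "HOL-Library.Sublist"
    "HOL-Library.Extended_Nat"
    "HOL-Library.Liminf_Limsup"
begin

definition extend_morphism :: "('a \<Rightarrow> 'b list) \<Rightarrow> 'a list \<Rightarrow> 'b list" where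
  "extend_morphism \<rho> w = concat (map \<rho> w)"

text \<open>All alphabets \<open>A n\<close> are finite subsets of one type of letters, and \<open>\<tau> n\<close> is a
  morphism from the words over \<open>A (n + 1)\<close> to the words over \<open>A n\<close>. The values of \<open>\<tau> n\<close>
  outside \<open>A (n + 1)\<close> are irrelevant.\<close>

definition directive_sequence :: "(nat \<Rightarrow> 'a set) \<Rightarrow> (nat \<Rightarrow> 'a \<Rightarrow> 'a list) \<Rightarrow> bool" where
  "directive_sequence A \<tau> \<longleftrightarrow>
     (\<forall>n. finite (A n)) \<and>
     (\<forall>n. \<forall>a\<in>A (n + 1). \<tau> n a \<in> lists (A n) \<and> \<tau> n a \<noteq> [])"

text \<open>The action on words of \<open>\<tau>\<^sub>n \<circ> \<tau>\<^sub>n\<^sub>+\<^sub>1 \<circ> \<dots> \<circ> \<tau>\<^sub>N\<^sub>-\<^sub>1\<close>; it is the identity for \<open>N = n\<close>.\<close>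

definition composed :: "(nat \<Rightarrow> 'a \<Rightarrow> 'a list) \<Rightarrow> nat \<Rightarrow> nat \<Rightarrow> 'a list \<Rightarrow> 'a list" where
  "composed \<tau> n N = foldr (\<lambda>i. extend_morphism (\<tau> i)) [n..<N]"

definition incidence_matrix :: "('a \<Rightarrow> 'b list) \<Rightarrow> 'a \<Rightarrow> 'b \<Rightarrow> nat" where
  "incidence_matrix \<rho> a b = count_list (\<rho> a) b"

definition primitive_directive :: "(nat \<Rightarrow> 'a set) \<Rightarrow> (nat \<Rightarrow> 'a \<Rightarrow> 'a list) \<Rightarrow> bool" where
  "primitive_directive A \<tau> \<longleftrightarrow>
     (\<forall>n\<ge>1. \<exists>N\<ge>n. \<forall>a\<in>A N. \<forall>b\<in>A n. incidence_matrix (\<lambda>c. composed \<tau> n N [c]) a b > 0)"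

definition full_shift :: "'a set \<Rightarrow> (int \<Rightarrow> 'a) topology" where
  "full_shift A = product_topology (\<lambda>_. discrete_topology A) UNIV"

definition shift_map :: "(int \<Rightarrow> 'a) \<Rightarrow> int \<Rightarrow> 'a" where
  "shift_map x = (\<lambda>i. x (i + 1))"

definition subshift :: "'a set \<Rightarrow> (int \<Rightarrow> 'a) set \<Rightarrow> bool" where
  "subshift A X \<longleftrightarrow> finite A \<and> closedin (full_shift A) X \<and> shift_map ` X = X"

definition subshift_space :: "'a set \<Rightarrow> (int \<Rightarrow> 'a) set \<Rightarrow> (int \<Rightarrow> 'a) topology" where
  "subshift_space A X = subtopology (full_shift A) X"

definition s_adic_language ::
  "(nat \<Rightarrow> 'a set) \<Rightarrow> (nat \<Rightarrow> 'a \<Rightarrow> 'a list) \<Rightarrow> nat \<Rightarrow> 'a list set" where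
  "s_adic_language A \<tau> n =
     {w \<in> lists (A n). \<exists>N>n. \<exists>a\<in>A N. sublist w (composed \<tau> n N [a])}"

text \<open>\<open>map x [i..j]\<close> is the factor of \<open>x\<close> between the positions \<open>i\<close> and \<open>j\<close>, both included.\<close>

definition s_adic_subshift ::
  "(nat \<Rightarrow> 'a set) \<Rightarrow> (nat \<Rightarrow> 'a \<Rightarrow> 'a list) \<Rightarrow> nat \<Rightarrow> (int \<Rightarrow> 'a) set" where
  "s_adic_subshift A \<tau> n =
     {x. range x \<subseteq> A n \<and> (\<forall>i j. map x [i..j] \<in> s_adic_language A \<tau> n)}"

definition minimal_system :: "'x topology \<Rightarrow> ('x \<Rightarrow> 'x) \<Rightarrow> bool" where
  "minimal_system X T \<longleftrightarrow>
     topspace X \<noteq> {} \<and> homeomorphic_map X X T \<and>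
     (\<forall>C. closedin X C \<and> T ` C = C \<longrightarrow> C = {} \<or> C = topspace X)"

definition topologically_conjugate ::
  "'x topology \<Rightarrow> ('x \<Rightarrow> 'x) \<Rightarrow> 'y topology \<Rightarrow> ('y \<Rightarrow> 'y) \<Rightarrow> bool" where
  "topologically_conjugate X T Y S \<longleftrightarrow>
     (\<exists>\<phi>. homeomorphic_map X Y \<phi> \<and> (\<forall>x\<in>topspace X. \<phi> (T x) = S (\<phi> x)))"

definition totally_disconnected_space :: "'x topology \<Rightarrow> bool" where
  "totally_disconnected_space X \<longleftrightarrow> (\<forall>C. connectedin X C \<longrightarrow> (\<exists>x. C \<subseteq> {x}))"

text \<open>A Kakutani-Rokhlin partition is given by the number \<open>k\<close> of its towers, their bases
  \<open>B 0, \<dots>, B (k - 1)\<close> and their heights \<open>h 0, \<dots>, h (k - 1)\<close>.\<close>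

definition kr_atoms ::
  "('x \<Rightarrow> 'x) \<Rightarrow> nat \<Rightarrow> (nat \<Rightarrow> 'x set) \<Rightarrow> (nat \<Rightarrow> nat) \<Rightarrow> 'x set set" where
  "kr_atoms T k B h = {(T ^^ j) ` B i | i j. i < k \<and> j < h i}"

definition kr_base :: "nat \<Rightarrow> (nat \<Rightarrow> 'x set) \<Rightarrow> 'x set" where
  "kr_base k B = (\<Union>i<k. B i)"

definition kr_partition ::
  "'x topology \<Rightarrow> ('x \<Rightarrow> 'x) \<Rightarrow> nat \<Rightarrow> (nat \<Rightarrow> 'x set) \<Rightarrow> (nat \<Rightarrow> nat) \<Rightarrow> bool" where
  "kr_partition X T k B h \<longleftrightarrow>
     (\<forall>i<k. 0 < h i) \<and>
     (\<forall>P\<in>kr_atoms T k B h. P \<noteq> {} \<and> openin X P \<and> closedin X P) \<and>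
     disjoint_family_on (\<lambda>(i, j). (T ^^ j) ` B i) (SIGMA i:{..<k}. {..<h i}) \<and>
     \<Union>(kr_atoms T k B h) = topspace X"

definition finite_topological_rank :: "'x topology \<Rightarrow> ('x \<Rightarrow> 'x) \<Rightarrow> bool" where
  "finite_topological_rank X T \<longleftrightarrow>
     compact_space X \<and> totally_disconnected_space X \<and> metrizable_space X \<and>
     minimal_system X T \<and>
     (\<exists>k B h.
        (\<forall>n::nat. kr_partition X T (k n) (B n) (h n)) \<and>
        (\<forall>n. \<forall>P\<in>kr_atoms T (k (Suc n)) (B (Suc n)) (h (Suc n)).
           \<exists>Q\<in>kr_atoms T (k n) (B n) (h n). P \<subseteq> Q) \<and>
        (\<forall>n. kr_base (k (Suc n)) (B (Suc n)) \<subseteq> kr_base (k n) (B n)) \<and>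
        (\<exists>x. (\<Inter>n. kr_base (k n) (B n)) = {x}) \<and>
        topology_generated_by (\<Union>n. kr_atoms T (k n) (B n) (h n)) = X \<and>
        (\<exists>K. \<forall>n. k n \<le> K))"

end

theory Submission
  imports Defs
begin

text \<open>The words \<open>\<tau>\<^bsub>[0,n)\<^esub>(a)\<close> with \<open>a \<in> A\<^sub>n\<close> cover the subshift \<open>X\<close>, and by primitivity a given
  word \<open>u v\<close> of the language occurs in each of them once \<open>n\<close> is large. Cutting all of them inside
  an occurrence of \<open>u v\<close> and regluing gives a set \<open>W\<close> of at most \<open>|A\<^sub>n|\<^sup>2\<close> words that covers \<open>X\<close> and
  whose members all begin with \<open>v\<close> and end with \<open>u\<close>.

  Points of \<open>X\<close> may factor over \<open>W\<close> in several ways. A clopen set \<open>U\<close> is coherent if the pair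
  (factor, offset) of the origin in any factorization decides membership in \<open>U\<close>. The cylinder
  \<open>[u.v]\<close> is coherent and contains all cuts. Take a smallest coherent clopen \<open>U \<subseteq> [u.v]\<close> that contains
  all cuts. If a return word of \<open>U\<close> were not the first piece into which \<open>U\<close> divides some word
  of \<open>W\<close>, the points with this return word could be removed from \<open>U\<close>. So \<open>U\<close> has at
  most \<open>|W|\<close> return words, and no recognizability is needed. Choosing such bases inside one another
  gives the Kakutani-Rokhlin partitions, with towers indexed by the return words.\<close>

section \<open>Symbolic systems\<close>

definition shift_by :: "int \<Rightarrow> (int \<Rightarrow> 'a) \<Rightarrow> int \<Rightarrow> 'a" where
  "shift_by t x = (\<lambda>i. x (i + t))"

definition agree :: "nat \<Rightarrow> (int \<Rightarrow> 'a) \<Rightarrow> (int \<Rightarrow> 'a) \<Rightarrow> bool" where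
  "agree m x y \<longleftrightarrow> (\<forall>i. \<bar>i\<bar> \<le> int m \<longrightarrow> x i = y i)"

text \<open>Clopen sets with an explicit window. Compactness provides such an \<open>m\<close> for
  every clopen subset of a subshift; carrying it along lets windows be compared
  quantitatively.\<close>

definition local_in :: "(int \<Rightarrow> 'a) set \<Rightarrow> nat \<Rightarrow> (int \<Rightarrow> 'a) set \<Rightarrow> bool" where
  "local_in X m U \<longleftrightarrow> U \<subseteq> X \<and> (\<forall>x\<in>U. \<forall>y\<in>X. agree m x y \<longrightarrow> y \<in> U)"

lemma shift_by_apply [simp]: "shift_by t x i = x (i + t)"
  by (simp add: shift_by_def)

lemma shift_by_0 [simp]: "shift_by 0 x = x"
  by (simp add: shift_by_def)

lemma shift_by_shift_by [simp]: "shift_by s (shift_by t x) = shift_by (s + t) x"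
  by (simp add: shift_by_def add.assoc)

lemma shift_map_eq: "shift_map = shift_by 1"
  by (simp add: fun_eq_iff shift_map_def)

lemma shift_map_funpow: "shift_map ^^ n = shift_by (int n)"
  by (induction n) (auto simp: fun_eq_iff shift_map_eq add_ac)

lemma agree_refl [simp]: "agree m x x"
  by (simp add: agree_def)

lemma agree_sym: "agree m x y \<Longrightarrow> agree m y x"
  by (simp add: agree_def)

lemma agree_trans: "agree m x y \<Longrightarrow> agree m y z \<Longrightarrow> agree m x z"
  by (simp add: agree_def)

lemma agree_mono: "agree n x y \<Longrightarrow> m \<le> n \<Longrightarrow> agree m x y"
  by (auto simp: agree_def)

lemma agree_shift_by: "agree (m + nat \<bar>t\<bar>) x y \<Longrightarrow> agree m (shift_by t x) (shift_by t y)"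
  unfolding agree_def by auto

lemma agree_all_eq: "(\<And>m. agree m x y) \<Longrightarrow> x = y"
proof
  fix i assume "\<And>m. agree m x y"
  from this[of "nat \<bar>i\<bar>"] show "x i = y i" by (simp add: agree_def)
qed

lemma local_in_iff: "local_in X m U \<Longrightarrow> x \<in> X \<Longrightarrow> y \<in> X \<Longrightarrow> agree m x y \<Longrightarrow> x \<in> U \<longleftrightarrow> y \<in> U"
  unfolding local_in_def using agree_sym by blast

lemma local_in_mono: "local_in X m U \<Longrightarrow> m \<le> n \<Longrightarrow> local_in X n U"
  unfolding local_in_def using agree_mono by blast

section \<open>Topology of the full shift and of its subspaces through agreement on windows\<close>

lemma topspace_full_shift: "topspace (full_shift A) = {x. range x \<subseteq> A}"
  by (auto simp: full_shift_def PiE_def)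

text \<open>A basic open box of the product restricts finitely many coordinates, all of which lie in
  one symmetric window; conversely, prescribing a window is such a box.\<close>

lemma openin_full_shift:
  "openin (full_shift A) S \<longleftrightarrow>
     S \<subseteq> topspace (full_shift A) \<and>
     (\<forall>x\<in>S. \<exists>m. \<forall>y\<in>topspace (full_shift A). agree m x y \<longrightarrow> y \<in> S)"
proof (intro iffI conjI ballI)
  assume S: "openin (full_shift A) S"
  show "S \<subseteq> topspace (full_shift A)" using S by (rule openin_subset)
  fix x assume "x \<in> S"
  with S obtain U where fin: "finite {i. U i \<noteq> A}" and U: "x \<in> PiE UNIV U" "PiE UNIV U \<subseteq> S"
    unfolding full_shift_def openin_product_topology_alt by auto
  \<comment> \<open>The element \<open>0\<close> keeps \<open>Max\<close> meaningful when no
    coordinate is restricted.\<close>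
  define m where "m = Max (insert 0 ((\<lambda>i. nat \<bar>i\<bar>) ` {i. U i \<noteq> A}))"
  have m: "U i = A" if "int m < \<bar>i\<bar>" for i
  proof (rule ccontr)
    assume "U i \<noteq> A"
    then have "nat \<bar>i\<bar> \<le> m" unfolding m_def using fin by (intro Max_ge) auto
    with that show False by linarith
  qed
  have "y \<in> S" if "y \<in> topspace (full_shift A)" "agree m x y" for y
  proof -
    have "y i \<in> U i" for i
    proof (cases "\<bar>i\<bar> \<le> int m")
      case True
      then show ?thesis using that(2) U(1) by (auto simp: agree_def PiE_def Pi_def) metis
    next
      case False
      then show ?thesis using that(1) m[of i] by (auto simp: topspace_full_shift)
    qed
    then show ?thesis using U(2) by auto
  qed
  then show "\<exists>m. \<forall>y\<in>topspace (full_shift A). agree m x y \<longrightarrow> y \<in> S" by blast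
next
  assume S: "S \<subseteq> topspace (full_shift A) \<and>
    (\<forall>x\<in>S. \<exists>m. \<forall>y\<in>topspace (full_shift A). agree m x y \<longrightarrow> y \<in> S)"
  show "openin (full_shift A) S"
    unfolding full_shift_def openin_product_topology_alt
  proof (intro ballI)
    fix x assume x: "x \<in> S"
    with S obtain m where m: "\<And>y. y \<in> topspace (full_shift A) \<Longrightarrow> agree m x y \<Longrightarrow> y \<in> S" by blast
    define U where "U = (\<lambda>i. if \<bar>i\<bar> \<le> int m then {x i} else A)"
    have xA: "x i \<in> A" for i using S x by (auto simp: topspace_full_shift)
    have "{i. U i \<noteq> A} \<subseteq> {- int m..int m}" by (auto simp: U_def split: if_splits)
    then have "finite {i. U i \<noteq> A}" using finite_subset by blast
    moreover have "U i \<subseteq> A" for i using xA by (auto simp: U_def)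
    moreover have "x \<in> PiE UNIV U" using xA by (auto simp: U_def)
    moreover have "PiE UNIV U \<subseteq> S"
    proof
      fix y assume y: "y \<in> PiE UNIV U"
      have yU: "y i \<in> U i" for i using y by auto
      then have "y \<in> topspace (full_shift A)"
        using \<open>\<And>i. U i \<subseteq> A\<close> by (auto simp: topspace_full_shift)
      moreover have "agree m x y"
        unfolding agree_def
      proof (intro allI impI)
        fix i assume "\<bar>i\<bar> \<le> int m"
        then show "x i = y i" using yU[of i] by (simp add: U_def)
      qed
      ultimately show "y \<in> S" by (rule m)
    qed
    ultimately show "\<exists>U. finite {i \<in> UNIV. U i \<noteq> topspace (discrete_topology A)} \<and>
        (\<forall>i\<in>UNIV. openin (discrete_topology A) (U i)) \<and> x \<in> PiE UNIV U \<and> PiE UNIV U \<subseteq> S"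
      by (intro exI[of _ U]) auto
  qed
qed

lemma closedin_full_shift:
  "closedin (full_shift A) S \<longleftrightarrow>
     S \<subseteq> topspace (full_shift A) \<and>
     (\<forall>x\<in>topspace (full_shift A). (\<forall>m. \<exists>y\<in>S. agree m x y) \<longrightarrow> x \<in> S)"
  unfolding closedin_def openin_full_shift by (auto; blast)

lemma openin_subshift_space:
  assumes "X \<subseteq> topspace (full_shift A)"
  shows "openin (subshift_space A X) S \<longleftrightarrow>
     S \<subseteq> X \<and> (\<forall>x\<in>S. \<exists>m. \<forall>y\<in>X. agree m x y \<longrightarrow> y \<in> S)"
proof
  assume "openin (subshift_space A X) S"
  then obtain T where T: "openin (full_shift A) T" "S = T \<inter> X"
    by (auto simp: subshift_space_def openin_subtopology)
  then show "S \<subseteq> X \<and> (\<forall>x\<in>S. \<exists>m. \<forall>y\<in>X. agree m x y \<longrightarrow> y \<in> S)"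
    using assms unfolding openin_full_shift by blast
next
  assume S: "S \<subseteq> X \<and> (\<forall>x\<in>S. \<exists>m. \<forall>y\<in>X. agree m x y \<longrightarrow> y \<in> S)"
  \<comment> \<open>\<open>T\<close> collects the points of the full shift that share with some
    \<open>x\<close> in \<open>S\<close> a window which already forces points of \<open>X\<close>
    into \<open>S\<close>.\<close>
  define T where "T = {y \<in> topspace (full_shift A). \<exists>x\<in>S. \<exists>m. agree m x y \<and> (\<forall>y\<in>X. agree m x y \<longrightarrow> y \<in> S)}"
  have "openin (full_shift A) T"
    unfolding openin_full_shift
  proof (intro conjI ballI)
    fix y assume "y \<in> T"
    then obtain x m where "x \<in> S" "agree m x y" "\<forall>y\<in>X. agree m x y \<longrightarrow> y \<in> S"
      unfolding T_def by blast
    then have "\<forall>z\<in>topspace (full_shift A). agree m y z \<longrightarrow> z \<in> T"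
      unfolding T_def using agree_trans by blast
    then show "\<exists>m. \<forall>z\<in>topspace (full_shift A). agree m y z \<longrightarrow> z \<in> T" ..
  qed (auto simp: T_def)
  moreover have "S = T \<inter> X"
  proof
    show "S \<subseteq> T \<inter> X"
    proof
      fix x assume x: "x \<in> S"
      then obtain m where "\<forall>y\<in>X. agree m x y \<longrightarrow> y \<in> S" using S by blast
      then have "x \<in> T" using x S assms agree_refl[of m x] unfolding T_def by blast
      then show "x \<in> T \<inter> X" using x S by blast
    qed
  qed (auto simp: T_def)
  ultimately show "openin (subshift_space A X) S"
    by (auto simp: subshift_space_def openin_subtopology)
qed

lemma compact_space_full_shift: "finite A \<Longrightarrow> compact_space (full_shift A)"
  by (simp add: full_shift_def compact_space_product_topology compact_space_discrete_topology)

lemma metrizable_space_full_shift: "metrizable_space (full_shift (A :: 'a set))"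
proof -
  \<comment> \<open>The criterion for metrizability of a product asks that only countably many
    factors have two or more points; here the index set itself is countable.\<close>
  have "countable {i \<in> (UNIV :: int set). \<not> (\<exists>a. A \<subseteq> {a})}"
    by (rule countableI_type)
  then show ?thesis
    by (simp add: full_shift_def metrizable_space_product_topology metrizable_space_discrete_topology)
qed

section \<open>Subshifts as compact, metrizable, totally disconnected systems\<close>

locale symbolic_system =
  fixes A :: "'a set" and X :: "(int \<Rightarrow> 'a) set"
  assumes subshift: "subshift A X"
begin

lemma finite_alphabet: "finite A"
  using subshift by (simp add: subshift_def)

lemma subset_full_shift: "X \<subseteq> topspace (full_shift A)"
  using subshift by (simp add: subshift_def closedin_subset)

lemma topspace_subshift_space [simp]: "topspace (subshift_space A X) = X"
  using subset_full_shift by (auto simp: subshift_space_def)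

lemma letter: "x \<in> X \<Longrightarrow> x i \<in> A"
  using subset_full_shift by (auto simp: topspace_full_shift)

lemma limit_mem:
  assumes "\<And>m. \<exists>y\<in>X. agree m x y"
  shows "x \<in> X"
proof -
  have "x i \<in> A" for i
  proof -
    obtain y where "y \<in> X" "agree (nat \<bar>i\<bar>) x y" using assms by blast
    then show ?thesis using letter[of y i] by (simp add: agree_def)
  qed
  then have "x \<in> topspace (full_shift A)" by (auto simp: topspace_full_shift)
  then show ?thesis using subshift assms unfolding subshift_def closedin_full_shift by blast
qed

text \<open>Forward shifts use that \<open>shift_map\<close> maps \<open>X\<close> into
  \<open>X\<close>, backward shifts that it maps \<open>X\<close> onto \<open>X\<close>.\<close>

lemma shift_by_mem:
  assumes "x \<in> X" shows "shift_by t x \<in> X"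
proof -
  have fw: "shift_by (int n) x \<in> X" if "x \<in> X" for n x
  proof (induction n)
    case (Suc n)
    have "shift_by (int (Suc n)) x = shift_map (shift_by (int n) x)" by (simp add: shift_map_eq)
    then show ?case using Suc subshift unfolding subshift_def by blast
  qed (simp add: that)
  have bw: "shift_by (- int n) x \<in> X" if "x \<in> X" for n x
  proof (induction n)
    case (Suc n)
    obtain y where y: "y \<in> X" "shift_by (- int n) x = shift_map y"
      using Suc subshift unfolding subshift_def by blast
    then have "shift_by (- 1) (shift_by (- int n) x) = y" by (simp add: shift_map_eq)
    moreover have "shift_by (- 1) (shift_by (- int n) x) = shift_by (- int (Suc n)) x"
      by (simp add: add.commute)
    ultimately show ?case using y by metis
  qed (simp add: that)
  show ?thesis by (cases t rule: int_cases2) (use fw bw assms in auto)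
qed

lemma shift_by_mem_iff [simp]: "shift_by t x \<in> X \<longleftrightarrow> x \<in> X"
  using shift_by_mem[of x t] shift_by_mem[of "shift_by t x" "- t"] by auto

lemma openin_iff:
  "openin (subshift_space A X) S \<longleftrightarrow> S \<subseteq> X \<and> (\<forall>x\<in>S. \<exists>m. \<forall>y\<in>X. agree m x y \<longrightarrow> y \<in> S)"
  using openin_subshift_space[OF subset_full_shift] .

lemma openin_local: "local_in X m U \<Longrightarrow> openin (subshift_space A X) U"
  unfolding openin_iff local_in_def by blast

lemma closedin_local: "local_in X m U \<Longrightarrow> closedin (subshift_space A X) U"
  unfolding closedin_def openin_iff local_in_def
  by auto (metis agree_sym)

lemma compact_subshift_space: "compact_space (subshift_space A X)"
  using subshift compact_space_full_shift[OF finite_alphabet]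
  by (auto simp: subshift_space_def subshift_def compact_space_subtopology closedin_compact_space)

lemma metrizable_subshift_space: "metrizable_space (subshift_space A X)"
  by (simp add: subshift_space_def metrizable_space_subtopology metrizable_space_full_shift)

text \<open>For each window the cylinders are clopen, so a connected set lies in a single one of
  them.\<close>

lemma totally_disconnected_subshift_space: "totally_disconnected_space (subshift_space A X)"
  unfolding totally_disconnected_space_def
proof (intro allI impI)
  fix C assume C: "connectedin (subshift_space A X) C"
  have "x = y" if "x \<in> C" "y \<in> C" for x y
  proof (rule agree_all_eq)
    fix m
    let ?U = "{z \<in> X. agree m x z}"
    have "local_in X m ?U" unfolding local_in_def using agree_trans by blast
    then have "C \<subseteq> ?U \<or> disjnt C ?U"
      using C closedin_local openin_local connectedin_clopen_cases by blast
    moreover have "x \<in> ?U" using that C connectedin_subset_topspace by fastforce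
    ultimately show "agree m x y" using that by (auto simp: disjnt_def)
  qed
  then show "\<exists>x. C \<subseteq> {x}" by blast
qed

lemma local_in_shift:
  assumes "local_in X m U"
  shows "local_in X (m + nat \<bar>t\<bar>) (shift_by t ` U)"
  unfolding local_in_def
proof (intro conjI ballI impI)
  show "shift_by t ` U \<subseteq> X" using assms by (auto simp: local_in_def)
  fix x y assume "x \<in> shift_by t ` U" and y: "y \<in> X" "agree (m + nat \<bar>t\<bar>) x y"
  then obtain z where z: "z \<in> U" "x = shift_by t z" by blast
  have "agree m (shift_by (- t) x) (shift_by (- t) y)" using y by (intro agree_shift_by) simp
  then have "shift_by (- t) y \<in> U" using assms z y unfolding local_in_def by simp
  then show "y \<in> shift_by t ` U" by (intro image_eqI[of _ _ "shift_by (- t) y"]) auto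
qed

lemma homeomorphic_shift_map:
  "homeomorphic_map (subshift_space A X) (subshift_space A X) shift_map"
proof -
  have cont: "continuous_map (subshift_space A X) (subshift_space A X) (shift_by t)" for t
    unfolding continuous_map_def
  proof (intro conjI allI impI)
    fix S assume S: "openin (subshift_space A X) S"
    show "openin (subshift_space A X) {x \<in> topspace (subshift_space A X). shift_by t x \<in> S}"
      unfolding openin_iff
    proof (intro conjI ballI)
      fix x assume "x \<in> {x \<in> topspace (subshift_space A X). shift_by t x \<in> S}"
      then have x: "shift_by t x \<in> S" by simp
      then obtain m where "\<forall>y\<in>X. agree m (shift_by t x) y \<longrightarrow> y \<in> S"
        using S openin_iff by blast
      then have "\<forall>y\<in>X. agree (m + nat \<bar>t\<bar>) x y \<longrightarrow> y \<in> {x \<in> topspace (subshift_space A X). shift_by t x \<in> S}"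
        using agree_shift_by by fastforce
      then show "\<exists>m. \<forall>y\<in>X. agree m x y \<longrightarrow> y \<in> {x \<in> topspace (subshift_space A X). shift_by t x \<in> S}" ..
    qed auto
  qed auto
  have "homeomorphic_maps (subshift_space A X) (subshift_space A X) (shift_by 1) (shift_by (- 1))"
    unfolding homeomorphic_maps_def using cont by simp
  then show ?thesis unfolding shift_map_eq by (rule homeomorphic_maps_map[THEN iffD1, THEN conjunct1])
qed

end

section \<open>Return words and factorizations\<close>

text \<open>The length of \<open>u\<close> is the first return time of \<open>x\<close> to
  \<open>U\<close>. Recording the word and not only the time allows points with equal return words
  to be compared letter by letter.\<close>

definition return_word :: "(int \<Rightarrow> 'a) set \<Rightarrow> (int \<Rightarrow> 'a) \<Rightarrow> 'a list \<Rightarrow> bool" where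
  "return_word U x u \<longleftrightarrow>
     x \<in> U \<and> u \<noteq> [] \<and> (\<forall>t<length u. x (int t) = u ! t) \<and> shift_by (int (length u)) x \<in> U \<and>
     (\<forall>t. 0 < t \<and> t < length u \<longrightarrow> shift_by (int t) x \<notin> U)"

definition return_words :: "(int \<Rightarrow> 'a) set \<Rightarrow> 'a list set" where
  "return_words U = {u. \<exists>x. return_word U x u}"

lemma return_word_length_le:
  assumes "return_word U x u" "shift_by (int t) x \<in> U" "0 < t"
  shows "length u \<le> t"
  using assms unfolding return_word_def by (meson not_le)

lemma return_word_unique:
  assumes "return_word U x u" "return_word U x v"
  shows "u = v"
proof -
  have "length u = length v"
    using return_word_length_le[OF assms(1), of "length v"] return_word_length_le[OF assms(2), of "length u"] assms
    unfolding return_word_def by (metis le_antisym length_greater_0_conv)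
  then show ?thesis
    using assms unfolding return_word_def by (metis nth_equalityI)
qed

lemma return_word_exists:
  assumes "x \<in> U" "shift_by (int t) x \<in> U" "0 < t"
  shows "\<exists>u. return_word U x u"
proof -
  define s where "s = (LEAST s. 0 < s \<and> shift_by (int s) x \<in> U)"
  have s: "0 < s \<and> shift_by (int s) x \<in> U"
    unfolding s_def by (rule LeastI[of _ t]) (use assms in auto)
  have "shift_by (int r) x \<notin> U" if "0 < r" "r < s" for r
    using not_less_Least[of r "\<lambda>s. 0 < s \<and> shift_by (int s) x \<in> U"] that unfolding s_def by blast
  then have "return_word U x (map (\<lambda>t. x (int t)) [0..<s])"
    using s assms(1) by (auto simp: return_word_def)
  then show ?thesis ..
qed

section \<open>Factorizations of bi-infinite words over a set of words\<close>

definition parse_step :: "'a list \<times> nat \<Rightarrow> 'a list \<times> nat \<Rightarrow> bool" where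
  "parse_step q r \<longleftrightarrow>
     (if Suc (snd q) < length (fst q) then r = (fst q, Suc (snd q)) else snd r = 0)"

definition positions :: "'a list set \<Rightarrow> ('a list \<times> nat) set" where
  "positions W = {(w, e). w \<in> W \<and> e < length w}"

text \<open>A factorization of \<open>x\<close> into words of \<open>W\<close>: \<open>f i = (w, e)\<close> says that the position \<open>i\<close>
  is at offset \<open>e\<close> in a factor \<open>w\<close>.\<close>

definition parse :: "'a list set \<Rightarrow> (int \<Rightarrow> 'a) \<Rightarrow> (int \<Rightarrow> 'a list \<times> nat) \<Rightarrow> bool" where
  "parse W x f \<longleftrightarrow>
     (\<forall>i. f i \<in> positions W \<and> x i = fst (f i) ! snd (f i) \<and> parse_step (f i) (f (i + 1)))"

lemma finite_positions: "finite W \<Longrightarrow> finite (positions W)"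
proof -
  assume "finite W"
  moreover have "positions W = (SIGMA w:W. {..<length w})" by (auto simp: positions_def)
  ultimately show ?thesis by auto
qed

lemma parse_shift_by: "parse W x f \<Longrightarrow> parse W (shift_by t x) (shift_by t f)"
  unfolding parse_def
proof
  fix i
  assume "\<forall>i. f i \<in> positions W \<and> x i = fst (f i) ! snd (f i) \<and> parse_step (f i) (f (i + 1))"
  from this[rule_format, of "i + t"] show "shift_by t f i \<in> positions W \<and>
      shift_by t x i = fst (shift_by t f i) ! snd (shift_by t f i) \<and>
      parse_step (shift_by t f i) (shift_by t f (i + 1))"
    by (simp add: add.assoc add.commute[of 1 t])
qed

lemma parseD:
  assumes "parse W x f" "f i = (w, e)"
  shows "w \<in> W" "e < length w" "x i = w ! e"
proof -
  have "f i \<in> positions W \<and> x i = fst (f i) ! snd (f i)" using assms(1) unfolding parse_def by blast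
  then show "w \<in> W" "e < length w" "x i = w ! e" using assms(2) by (auto simp: positions_def)
qed

lemma parse_forward:
  assumes "parse W x f" "f i = (w, e)" "e + t < length w"
  shows "f (i + int t) = (w, e + t)"
  using assms(3)
proof (induction t)
  case (Suc t)
  then have "f (i + int t) = (w, e + t)" by simp
  then have "f (i + int t + 1) = (w, Suc (e + t))"
    using assms(1) Suc.prems unfolding parse_def parse_step_def
    by (metis add_Suc_right fst_conv snd_conv)
  then show ?case by (simp add: add_ac)
qed (use assms in simp)

lemma parse_next:
  assumes "parse W x f" "f i = (w, e)"
  shows "snd (f (i + int (length w - e))) = 0"
proof -
  have "e < length w" using parseD assms by blast
  then obtain t where t: "length w - e = Suc t" "e + t < length w" "Suc (e + t) = length w"
    by (metis Suc_diff_Suc add_Suc_right le_add_diff_inverse lessI less_imp_le_nat)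
  then have "f (i + int t) = (w, e + t)" using parse_forward assms by blast
  then have "snd (f (i + int t + 1)) = 0"
    using assms(1) t unfolding parse_def parse_step_def by (metis fst_conv less_irrefl snd_conv)
  then show ?thesis by (simp add: t add_ac)
qed

text \<open>A position with positive offset can only follow the previous offset of the same factor,
  since leaving a factor forces offset 0.\<close>

lemma parse_backward:
  assumes "parse W x f" "f i = (w, e)" "t \<le> e"
  shows "f (i - int t) = (w, e - t)"
  using assms(3)
proof (induction t)
  case (Suc t)
  then have *: "f (i - int t) = (w, e - t)" by simp
  let ?j = "i - int (Suc t)"
  have "parse_step (f ?j) (f (?j + 1))" "f ?j \<in> positions W" using assms(1) unfolding parse_def by blast+
  moreover have "?j + 1 = i - int t" by simp
  ultimately have "parse_step (f ?j) (w, e - t)" using * by metis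
  then have "f ?j = (w, e - Suc t)"
    using Suc.prems unfolding parse_step_def by (cases "f ?j") (auto split: if_splits)
  then show ?case .
qed (use assms in simp)

lemma parse_before:
  assumes "parse W x f" "snd (f i) = 0"
  shows "\<exists>w. f (i - 1) = (w, length w - 1)"
proof -
  have "parse_step (f (i - 1)) (f (i - 1 + 1))" "f (i - 1) \<in> positions W"
    using assms(1) unfolding parse_def by blast+
  then show ?thesis using assms(2)
    by (cases "f (i - 1)") (auto simp: parse_step_def positions_def split: if_splits)
qed

text \<open>\<open>l\<close> is the evident factorization of the finite word
  \<open>concat ws\<close>, written as a list of positions; \<open>parse_exists\<close> builds its
  approximations from such lists.\<close>

lemma concat_positions:
  fixes ws :: "'a list list"
  defines "l \<equiv> concat (map (\<lambda>w. map (Pair w) [0..<length w]) ws)"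
  assumes "[] \<notin> set ws"
  shows "length l = length (concat ws)"
    and "\<And>k. k < length l \<Longrightarrow> l ! k \<in> positions (set ws) \<and> fst (l ! k) ! snd (l ! k) = concat ws ! k"
    and "\<And>k. Suc k < length l \<Longrightarrow> parse_step (l ! k) (l ! Suc k)"
proof -
  \<comment> \<open>The additional conjunct on \<open>l ! 0\<close> is what the induction needs at
    the junction of the first word with the rest.\<close>
  have "length l = length (concat ws) \<and> (l \<noteq> [] \<longrightarrow> snd (l ! 0) = 0) \<and>
    (\<forall>k<length l. l ! k \<in> positions (set ws) \<and> fst (l ! k) ! snd (l ! k) = concat ws ! k) \<and>
    (\<forall>k. Suc k < length l \<longrightarrow> parse_step (l ! k) (l ! Suc k))"
    using assms(2) unfolding l_def
  proof (induction ws)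
    case (Cons w ws)
    let ?l = "concat (map (\<lambda>w. map (Pair w) [0..<length w]) ws)"
    let ?l' = "map (Pair w) [0..<length w] @ ?l"
    have IH: "length ?l = length (concat ws)" "?l \<noteq> [] \<longrightarrow> snd (?l ! 0) = 0"
      "\<And>k. k < length ?l \<Longrightarrow> ?l ! k \<in> positions (set ws) \<and> fst (?l ! k) ! snd (?l ! k) = concat ws ! k"
      "\<And>k. Suc k < length ?l \<Longrightarrow> parse_step (?l ! k) (?l ! Suc k)"
      using Cons by auto
    have nth1: "?l' ! k = (w, k)" if "k < length w" for k
      using that by (simp add: nth_append)
    have nth2: "?l' ! k = ?l ! (k - length w)" if "length w \<le> k" for k
      using that by (simp add: nth_append)
    have "?l' ! k \<in> positions (set (w # ws)) \<and> fst (?l' ! k) ! snd (?l' ! k) = concat (w # ws) ! k"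
      if "k < length ?l'" for k
    proof (cases "k < length w")
      case True
      then show ?thesis unfolding nth1[OF True] by (simp add: positions_def nth_append)
    next
      case False
      then have "k - length w < length ?l" using that by auto
      then show ?thesis using IH(3)[of "k - length w"] False nth2[of k]
        by (auto simp: nth_append positions_def)
    qed
    moreover have "parse_step (?l' ! k) (?l' ! Suc k)" if "Suc k < length ?l'" for k
    proof -
      consider "Suc k < length w" | "Suc k = length w" | "length w \<le> k" by linarith
      then show ?thesis
      proof cases
        case 1
        then show ?thesis using nth1[of k] nth1[of "Suc k"] by (simp add: parse_step_def)
      next
        case 2
        then have "?l \<noteq> []" using that by auto
        then show ?thesis using nth1[of k] nth2[of "Suc k"] 2 IH(2) by (simp add: parse_step_def)
      next
        case 3
        then show ?thesis using nth2[of k] nth2[of "Suc k"] IH(4)[of "k - length w"] that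
          by (simp add: Suc_diff_le)
      qed
    qed
    moreover have "?l' ! 0 = (w, 0)" by (rule nth1) (use Cons.prems in auto)
    then have "snd (?l' ! 0) = 0" by (simp only: snd_conv)
    moreover have "length ?l' = length (concat (w # ws))" using IH(1) by simp
    moreover have eq: "concat (map (\<lambda>w. map (Pair w) [0..<length w]) (w # ws)) = ?l'" by simp
    ultimately show ?case unfolding eq by blast
  qed simp
  then show "length l = length (concat ws)"
    "\<And>k. k < length l \<Longrightarrow> l ! k \<in> positions (set ws) \<and> fst (l ! k) ! snd (l ! k) = concat ws ! k"
    "\<And>k. Suc k < length l \<Longrightarrow> parse_step (l ! k) (l ! Suc k)" by blast+
qed

text \<open>Compactness: \<open>F m\<close> asks for the rules of a factorization only at the places
  from \<open>- m\<close> to \<open>m\<close>. As the rules are local, these sets are closed and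
  nested in the full shift over the finite set of positions. Each is nonempty because a slightly
  longer factor of \<open>x\<close> lies in a concatenation. A common point is a factorization of
  \<open>x\<close>.\<close>

lemma parse_exists:
  assumes "finite W" "[] \<notin> W"
    and "\<And>i j. \<exists>ws\<in>lists W. sublist (map x [i..j]) (concat ws)"
  shows "\<exists>f. parse W x f"
proof -
  let ?Q = "positions W"
  define F where "F = (\<lambda>m. {f. range f \<subseteq> ?Q \<and>
    (\<forall>i. \<bar>i\<bar> \<le> int m \<longrightarrow> x i = fst (f i) ! snd (f i) \<and> parse_step (f i) (f (i + 1)))})"
  have "compact_space (full_shift ?Q)"
    using assms(1) by (intro compact_space_full_shift finite_positions)
  moreover have "closedin (full_shift ?Q) (F m)" for m
    unfolding closedin_full_shift
  proof (intro conjI ballI impI)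
    fix f assume f: "f \<in> topspace (full_shift ?Q)" "\<forall>n. \<exists>g\<in>F m. agree n f g"
    \<comment> \<open>The window is \<open>Suc m\<close> because the rule at the place
      \<open>m\<close> also looks at the place \<open>m + 1\<close>.\<close>
    then obtain g where g: "g \<in> F m" "agree (Suc m) f g" by blast
    have "x i = fst (f i) ! snd (f i) \<and> parse_step (f i) (f (i + 1))" if "\<bar>i\<bar> \<le> int m" for i
    proof -
      have "f i = g i" "f (i + 1) = g (i + 1)" using g(2) that unfolding agree_def by auto
      then show ?thesis using g(1) that unfolding F_def by auto
    qed
    then show "f \<in> F m" using f(1) by (auto simp: F_def topspace_full_shift)
  qed (auto simp: F_def topspace_full_shift)
  moreover have "F m \<noteq> {}" for m
  proof -
    define n where "n = int (Suc m)"
    obtain ws p s where ws: "ws \<in> lists W" "concat ws = p @ map x [-n..n] @ s"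
      using assms(3)[of "-n" n] by (auto simp: sublist_def)
    define l where "l = concat (map (\<lambda>w. map (Pair w) [0..<length w]) ws)"
    have "[] \<notin> set ws" using assms(2) ws(1) by auto
    note l = concat_positions[OF this, folded l_def]
    have len: "nat (i + n) + length p < length l" if "\<bar>i\<bar> \<le> n" for i
      using that by (simp add: l(1) ws(2))
    have sub: "positions (set ws) \<subseteq> ?Q" using ws(1) by (auto simp: positions_def)
    \<comment> \<open>Outside the window \<open>l ! 0\<close> is a dummy: it is a position, and
      \<open>F m\<close> imposes no other condition there.\<close>
    define f where "f = (\<lambda>i. l ! (if \<bar>i\<bar> \<le> n then nat (i + n) + length p else 0))"
    have "f i \<in> ?Q" for i
    proof -
      have "0 < length l" using len[of 0] n_def by linarith
      then show ?thesis using l(2) len[of i] sub unfolding f_def by (auto split: if_splits)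
    qed
    moreover have "x i = fst (f i) ! snd (f i) \<and> parse_step (f i) (f (i + 1))" if i: "\<bar>i\<bar> \<le> int m" for i
    proof
      have n: "\<bar>i\<bar> \<le> n" "\<bar>i + 1\<bar> \<le> n" "nat (i + 1 + n) = Suc (nat (i + n))"
        using i by (auto simp: n_def)
      have "fst (f i) ! snd (f i) = concat ws ! (nat (i + n) + length p)"
        using l(2) len n by (simp add: f_def)
      also have "\<dots> = map x [-n..n] ! nat (i + n)"
        using n(1) by (simp add: ws(2) nth_append abs_le_iff)
      also have "\<dots> = x i" using n(1) by (simp add: nth_upto abs_le_iff)
      finally show "x i = fst (f i) ! snd (f i)" ..
      show "parse_step (f i) (f (i + 1))"
        using l(3)[of "nat (i + n) + length p"] len[of "i + 1"] n by (simp add: f_def)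
    qed
    ultimately have "f \<in> F m" by (auto simp: F_def)
    then show ?thesis by blast
  qed
  moreover have "decseq F" unfolding F_def decseq_def by fastforce
  ultimately have "(\<Inter>m. F m) \<noteq> {}" by (rule compact_space_imp_nest)
  then obtain f where f: "\<And>m. f \<in> F m" by blast
  have "parse W x f"
    unfolding parse_def
  proof
    fix i
    show "f i \<in> ?Q \<and> x i = fst (f i) ! snd (f i) \<and> parse_step (f i) (f (i + 1))"
      using f[of "nat \<bar>i\<bar>"] unfolding F_def by auto
  qed
  then show ?thesis by blast
qed

section \<open>Coherent sets\<close>

text \<open>Whether \<open>u\<close> is a return word is decided by visits to \<open>U\<close> at
  times from 0 to the length of \<open>u\<close>, and each visit sees \<open>m\<close> letters on
  both sides.\<close>

lemma return_word_cong:
  assumes U: "local_in X m U" and X: "\<And>t. shift_by t x \<in> X" "\<And>t. shift_by t y \<in> X"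
    and xy: "\<And>i. - int m \<le> i \<Longrightarrow> i \<le> int m + int (length u) \<Longrightarrow> x i = y i"
  shows "return_word U x u \<longleftrightarrow> return_word U y u"
proof -
  have "agree m (shift_by (int t) x) (shift_by (int t) y)" if "t \<le> length u" for t
    unfolding agree_def using that by (auto intro: xy)
  then have sh: "shift_by (int t) x \<in> U \<longleftrightarrow> shift_by (int t) y \<in> U" if "t \<le> length u" for t
    using local_in_iff[OF U X] that by blast
  have "x (int t) = y (int t)" if "t < length u" for t
    using that by (intro xy) auto
  moreover have "x \<in> U \<longleftrightarrow> y \<in> U" using sh[of 0] by simp
  ultimately show ?thesis
    using sh[of "length u"] sh[OF less_imp_le] unfolding return_word_def by auto
qed

text \<open>If the window sticks out of the factor at the origin, it reads a suffix \<open>u\<close>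
  on the left and a prefix \<open>v\<close> on the right, whichever the neighbouring factors are. So
  it depends on the pair of factor and offset alone, which makes the cylinder of \<open>u\<close>
  and \<open>v\<close> coherent.\<close>

lemma parse_window:
  assumes f: "parse W x f" "f 0 = (w, e)"
    and W: "\<And>w. w \<in> W \<Longrightarrow> \<exists>t. w = v @ t" "\<And>w. w \<in> W \<Longrightarrow> \<exists>t. w = t @ u"
    and uv: "length u = m" "length v = Suc m"
    and i: "\<bar>i\<bar> \<le> int m"
  shows "x i = (if i < - int e then u ! nat (int m + i + int e)
                else if i < int (length w) - int e then w ! nat (i + int e)
                else v ! nat (i + int e - int (length w)))"
proof -
  note e = parseD(2)[OF f]
  consider "i < - int e" | "- int e \<le> i" "i < 0" | "0 \<le> i" "i < int (length w) - int e" | "int (length w) - int e \<le> i"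
    by linarith
  then show ?thesis
  proof cases
    case 1
    \<comment> \<open>\<open>s\<close> counts letters backwards from the last letter of the
      preceding factor; \<open>s < m\<close> keeps the place inside the suffix
      \<open>u\<close>.\<close>
    define s where "s = nat (- int e - 1 - i)"
    have s: "i = - int e - 1 - int s" "s < m" using 1 i by (auto simp: s_def)
    have "f (- int e) = (w, 0)" using parse_backward[OF f, of e] by simp
    then obtain w' where w': "f (- int e - 1) = (w', length w' - 1)"
      using parse_before[OF f(1), of "- int e"] by auto
    then have "w' \<in> W" using parseD f(1) by blast
    then obtain t where t: "w' = t @ u" using W(2) by blast
    have "f i = (w', length w' - 1 - s)"
      using parse_backward[OF f(1) w', of s] s uv t by simp
    then have "x i = w' ! (length w' - 1 - s)" using parseD f(1) by blast
    also have "length w' - 1 - s = length t + (m - 1 - s)" using s(2) uv t by simp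
    also have "w' ! (length t + (m - 1 - s)) = u ! (m - 1 - s)" by (simp add: t)
    also have "m - 1 - s = nat (int m + i + int e)" using s by linarith
    finally show ?thesis using 1 by simp
  next
    case 2
    have "f i = (w, e - nat (- i))" using parse_backward[OF f, of "nat (- i)"] 2 by simp
    then have "x i = w ! (e - nat (- i))" using parseD f(1) by blast
    moreover have "e - nat (- i) = nat (i + int e)" using 2 by linarith
    ultimately show ?thesis using 2 e by simp
  next
    case 3
    have "f i = (w, e + nat i)" using parse_forward[OF f, of "nat i"] 3 by simp
    then have "x i = w ! (e + nat i)" using parseD f(1) by blast
    moreover have "e + nat i = nat (i + int e)" using 3 by linarith
    ultimately show ?thesis using 3 by simp
  next
    case 4
    define k where "k = int (length w - e)"
    have k: "k = int (length w) - int e" using e by (simp add: k_def)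
    obtain w' where w': "f k = (w', 0)"
      using parse_next[OF f] by (metis add_0 k_def prod.collapse)
    then have "w' \<in> W" using parseD f(1) by blast
    then obtain t where t: "w' = v @ t" using W(1) by blast
    have lt: "nat (i - k) < length v" using 4 i uv k e by linarith
    then have "f i = (w', nat (i - k))"
      using parse_forward[OF f(1) w', of "nat (i - k)"] 4 t k by simp
    then have "x i = w' ! nat (i - k)" using parseD f(1) by blast
    also have "\<dots> = v ! nat (i - k)" using lt by (simp add: t nth_append)
    also have "i - k = i + int e - int (length w)" using k by simp
    finally show ?thesis using 4 e by simp
  qed
qed

text \<open>Demanding the same answer from all factorizations of a point takes the place of
  recognizability. The set \<open>I\<close> is kept explicit because, for finite \<open>W\<close>,
  its cardinality can be minimized.\<close>

definition coherent ::
  "(int \<Rightarrow> 'a) set \<Rightarrow> 'a list set \<Rightarrow> (int \<Rightarrow> 'a) set \<Rightarrow> ('a list \<times> nat) set \<Rightarrow> bool" where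
  "coherent X W U I \<longleftrightarrow>
     I \<subseteq> positions W \<and> (\<forall>x\<in>X. \<forall>f. parse W x f \<longrightarrow> (x \<in> U \<longleftrightarrow> f 0 \<in> I))"

definition contains_cuts :: "(int \<Rightarrow> 'a) set \<Rightarrow> 'a list set \<Rightarrow> (int \<Rightarrow> 'a) set \<Rightarrow> bool" where
  "contains_cuts X W U \<longleftrightarrow> (\<forall>x\<in>X. \<forall>f. parse W x f \<longrightarrow> snd (f 0) = 0 \<longrightarrow> x \<in> U)"

text \<open>The return word as it can be computed from \<open>w\<close> and \<open>I\<close> alone,
  without a point. The end of \<open>w\<close> counts as a return, as it does when all cuts belong
  to the base.\<close>

definition piece :: "('a list \<times> nat) set \<Rightarrow> 'a list \<Rightarrow> nat \<Rightarrow> 'a list \<Rightarrow> bool" where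
  "piece I w e u \<longleftrightarrow>
     u \<noteq> [] \<and> e + length u \<le> length w \<and> (\<forall>t<length u. w ! (e + t) = u ! t) \<and>
     (e + length u < length w \<longrightarrow> (w, e + length u) \<in> I) \<and>
     (\<forall>t. 0 < t \<and> t < length u \<longrightarrow> (w, e + t) \<notin> I)"

text \<open>The end of a shorter piece would be a position of \<open>I\<close> strictly inside the
  longer one.\<close>

lemma piece_unique:
  assumes u: "piece I w e u" and v: "piece I w e v"
  shows "u = v"
proof -
  have "\<not> length u < length v" if "piece I w e u" "piece I w e v" for u v
  proof
    assume "length u < length v"
    moreover have "0 < length u" using that(1) by (simp add: piece_def)
    ultimately have "(w, e + length u) \<notin> I" "e + length u < length w"
      using that(2) unfolding piece_def by auto
    then show False using that(1) by (simp add: piece_def)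
  qed
  then have "length u = length v" using u v by (metis linorder_neqE_nat)
  then show ?thesis using u v unfolding piece_def by (metis nth_equalityI)
qed

context symbolic_system
begin

lemma coherent_shift:
  assumes "coherent X W U I" "x \<in> X" "parse W x f" "f 0 = (w, e)" "e + t < length w"
  shows "shift_by (int t) x \<in> U \<longleftrightarrow> (w, e + t) \<in> I"
proof -
  have "shift_by (int t) f 0 = (w, e + t)" using parse_forward[OF assms(3-5)] by simp
  then show ?thesis
    using assms(1) parse_shift_by[OF assms(3), of "int t"] shift_by_mem[OF assms(2)]
    unfolding coherent_def by metis
qed

lemma contains_cuts_shift:
  assumes "contains_cuts X W U" "x \<in> X" "parse W x f" "f 0 = (w, e)"
  shows "shift_by (int (length w - e)) x \<in> U"
proof -
  have "snd (shift_by (int (length w - e)) f 0) = 0" using parse_next[OF assms(3,4)] by simp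
  then show ?thesis
    using assms(1) parse_shift_by[OF assms(3)] shift_by_mem[OF assms(2)]
    unfolding contains_cuts_def by blast
qed

text \<open>The next cut lies in \<open>U\<close>, so the return happens no later than the end of
  the current factor. The return word is thus contained in \<open>w\<close>, where coherence decides
  every visit.\<close>

lemma return_word_iff_piece:
  assumes coh: "coherent X W U I" and cuts: "contains_cuts X W U" and x: "x \<in> X" "x \<in> U"
    and f: "parse W x f" "f 0 = (w, e)"
  shows "return_word U x u \<longleftrightarrow> piece I w e u"
proof -
  note sh = coherent_shift[OF coh x(1) f]
  note en = contains_cuts_shift[OF cuts x(1) f]
  note e = parseD(2)[OF f]
  have letters: "x (int t) = w ! (e + t)" if "e + t < length w" for t
    using parse_forward[OF f that] parseD(3)[OF f(1)] by simp
  have le: "e + length u \<le> length w" if "return_word U x u"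
    using return_word_length_le[OF that en] e by simp
  show ?thesis
  proof
    assume r: "return_word U x u"
    then show "piece I w e u"
      using le[OF r] sh[of "length u"] sh letters unfolding return_word_def piece_def by simp
  next
    assume p: "piece I w e u"
    then have "shift_by (int (length u)) x \<in> U"
    proof (cases "e + length u < length w")
      \<comment> \<open>The piece ends together with the factor, and the return is the next
        cut.\<close>
      case False
      then have "e + length u = length w" using p unfolding piece_def by linarith
      then have "length w - e = length u" by linarith
      then show ?thesis using en by simp
    qed (use sh[of "length u"] in \<open>simp add: piece_def\<close>)
    then show "return_word U x u"
      using p sh letters x unfolding return_word_def piece_def by simp
  qed
qed

lemma return_word_agree:
  assumes "local_in X m U" "x \<in> X" "y \<in> X" "agree (m + length u) x y"
  shows "return_word U x u \<longleftrightarrow> return_word U y u"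
proof (rule return_word_cong[OF assms(1)])
  show "x i = y i" if "- int m \<le> i" "i \<le> int m + int (length u)" for i
    using assms(4) that unfolding agree_def by simp
qed (use assms in simp_all)

lemma local_in_return_word:
  assumes "local_in X m U"
  shows "local_in X (m + length u) {x \<in> X. return_word U x u}"
  unfolding local_in_def
proof (intro conjI ballI impI)
  fix x y assume xy: "x \<in> {x \<in> X. return_word U x u}" "y \<in> X" "agree (m + length u) x y"
  then have "return_word U y u" using return_word_agree[OF assms _ xy(2,3)] by blast
  then show "y \<in> {x \<in> X. return_word U x u}" using xy by blast
qed blast

text \<open>If \<open>u\<close> is not the first piece of a factor, then no cut of a factorization is followed by the
  return word \<open>u\<close>, and the points with this return word can be discarded.\<close>

lemma discard_return_word:
  assumes loc: "local_in X m U" and coh: "coherent X W U I" and cuts: "contains_cuts X W U"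
    and parses: "\<forall>x\<in>X. \<exists>f. parse W x f"
    and u: "u \<in> return_words U" and no_first: "\<forall>w\<in>W. \<not> piece I w 0 u"
  shows "\<exists>U' I' m'. local_in X m' U' \<and> coherent X W U' I' \<and> contains_cuts X W U' \<and>
           U' \<subseteq> U \<and> I' \<subset> I"
proof -
  define U' where "U' = {x \<in> U. \<not> return_word U x u}"
  \<comment> \<open>By \<open>return_word_iff_piece\<close>, discarding the return word
    \<open>u\<close> amounts to deleting positions from \<open>I\<close>, whatever the
    factorization; hence coherence survives.\<close>
  define I' where "I' = {(w, e) \<in> I. \<not> piece I w e u}"
  have loc': "local_in X (m + length u) U'"
    unfolding local_in_def
  proof (intro conjI ballI impI)
    show "U' \<subseteq> X" using loc by (auto simp: U'_def local_in_def)
    fix x y assume xy: "x \<in> U'" "y \<in> X" "agree (m + length u) x y"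
    then have "y \<in> U" using loc agree_mono[of "m + length u" x y m] unfolding local_in_def U'_def by auto
    moreover have "\<not> return_word U y u"
      using xy return_word_agree[OF loc _ xy(2,3)] loc unfolding local_in_def U'_def by auto
    ultimately show "y \<in> U'" by (simp add: U'_def)
  qed
  have coh': "x \<in> U' \<longleftrightarrow> f 0 \<in> I'" if x: "x \<in> X" and f: "parse W x f" for x f
  proof -
    obtain w e where we: "f 0 = (w, e)" by (cases "f 0")
    have "x \<in> U \<longleftrightarrow> (w, e) \<in> I" using coh x f we unfolding coherent_def by auto
    then show ?thesis
      using return_word_iff_piece[OF coh cuts x _ f we, of u] by (auto simp: U'_def I'_def we)
  qed
  moreover have "I' \<subseteq> I" by (auto simp: I'_def)
  then have "coherent X W U' I'" using coh coh' by (auto simp: coherent_def)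
  moreover have "contains_cuts X W U'"
    unfolding contains_cuts_def
  proof (intro ballI allI impI)
    fix x f assume x: "x \<in> X" and f: "parse W x f" and "snd (f 0) = 0"
    then obtain w where w: "f 0 = (w, 0)" by (metis prod.collapse)
    have "x \<in> U" using cuts x f w unfolding contains_cuts_def by auto
    moreover have "\<not> return_word U x u"
      using return_word_iff_piece[OF coh cuts x calculation f w] no_first parseD(1)[OF f w] by blast
    ultimately show "x \<in> U'" by (simp add: U'_def)
  qed
  \<comment> \<open>A point with return word \<open>u\<close> has some factorization, and its
    position at the origin is in \<open>I\<close> but not in \<open>I'\<close>.\<close>
  moreover have "I' \<subset> I"
  proof -
    obtain x where x: "return_word U x u" using u by (auto simp: return_words_def)
    then have xU: "x \<in> U" "x \<in> X" using loc by (auto simp: return_word_def local_in_def)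
    then obtain f where f: "parse W x f" using parses by blast
    have "f 0 \<in> I" using coh xU f unfolding coherent_def by blast
    moreover have "f 0 \<notin> I'" using coh'[OF xU(2) f] x by (auto simp: U'_def)
    ultimately show ?thesis using \<open>I' \<subseteq> I\<close> by blast
  qed
  moreover have "U' \<subseteq> U" by (auto simp: U'_def)
  ultimately show ?thesis using loc' by blast
qed

text \<open>Minimality is taken with respect to the cardinality of the position set
  \<open>I\<close>. By \<open>discard_return_word\<close> every return word of the minimal base is
  then the first piece of some \<open>w\<close> in \<open>W\<close>. A word has only one first
  piece, so choosing such a \<open>w\<close> is injective.\<close>

lemma few_return_words:
  assumes W: "finite W" and parses: "\<forall>x\<in>X. \<exists>f. parse W x f"
    and y: "y \<in> X"
    and pre: "\<forall>w\<in>W. \<exists>t. w = map y [0..int m] @ t"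
    and suf: "\<forall>w\<in>W. \<exists>t. w = t @ map y [- int m..- 1]"
  obtains U n where "local_in X n U" "\<And>x. x \<in> U \<Longrightarrow> agree m y x"
    "finite (return_words U)" "card (return_words U) \<le> card W"
    "\<And>x. x \<in> X \<Longrightarrow> \<exists>t. shift_by (- int t) x \<in> U" "\<And>x. x \<in> U \<Longrightarrow> \<exists>u. return_word U x u"
proof -
  define u v where uv: "u = map y [- int m..- 1]" "v = map y [0..int m]"
  have len: "length u = m" "length v = Suc m" by (auto simp: uv)
  have window: "x i = (if i < - int e then u ! nat (int m + i + int e)
                else if i < int (length w) - int e then w ! nat (i + int e)
                else v ! nat (i + int e - int (length w)))"
    if "parse W x f" "f 0 = (w, e)" "\<bar>i\<bar> \<le> int m" for x f w e i
    by (rule parse_window[OF that(1,2) _ _ len that(3)]) (simp_all add: uv pre suf)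
  define U0 where "U0 = {x \<in> X. agree m y x}"
  \<comment> \<open>The positions that occur over the cylinder \<open>U0\<close>; by
    \<open>window\<close>, any other point with one of these positions has the same central
    window.\<close>
  define I0 where "I0 = {q. \<exists>x\<in>U0. \<exists>f. parse W x f \<and> f 0 = q}"
  define P where "P = (\<lambda>I. \<exists>U n. local_in X n U \<and> coherent X W U I \<and> contains_cuts X W U \<and> U \<subseteq> U0)"
  have "local_in X m U0" unfolding local_in_def U0_def using agree_trans by blast
  moreover have "coherent X W U0 I0"
    unfolding coherent_def
  proof (intro conjI ballI allI impI)
    show "I0 \<subseteq> positions W"
    proof
      fix q assume "q \<in> I0"
      then obtain x f where "parse W x f" "f 0 = q" by (auto simp: I0_def)
      then show "q \<in> positions W" unfolding parse_def by blast
    qed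
    fix x f assume x: "x \<in> X" and f: "parse W x f"
    show "x \<in> U0 \<longleftrightarrow> f 0 \<in> I0"
    proof
      assume "f 0 \<in> I0"
      then obtain x' f' where x': "x' \<in> U0" "parse W x' f'" "f' 0 = f 0" by (auto simp: I0_def)
      obtain w e where we: "f 0 = (w, e)" by (cases "f 0")
      have "agree m x' x"
        unfolding agree_def using window[OF f we] window[OF x'(2), of w e] x'(3) we by simp
      then show "x \<in> U0" using x x'(1) agree_trans unfolding U0_def by blast
    qed (use f in \<open>auto simp: I0_def\<close>)
  qed
  moreover have "contains_cuts X W U0"
    unfolding contains_cuts_def
  proof (intro ballI allI impI)
    fix x f assume x: "x \<in> X" and f: "parse W x f" and "snd (f 0) = 0"
    then obtain w where w: "f 0 = (w, 0)" by (metis prod.collapse)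
    obtain t where t: "w = v @ t" using pre parseD(1)[OF f w] unfolding uv by blast
    \<comment> \<open>At a cut the window is the suffix \<open>u\<close> of the preceding factor
      followed by the prefix \<open>v\<close> of the next one, which is the window of
      \<open>y\<close>.\<close>
    have "y i = x i" if i: "\<bar>i\<bar> \<le> int m" for i
    proof (cases "i < 0")
      case True
      then have "u ! nat (int m + i) = y i" using i by (simp add: uv nth_upto)
      then show ?thesis using window[OF f w i] True by simp
    next
      case False
      then have "v ! nat i = y i" using i by (simp add: uv nth_upto)
      moreover have "nat i < length v" "i < int (length w)" using i len t by auto
      ultimately show ?thesis using window[OF f w i] False t by (simp add: nth_append)
    qed
    then show "x \<in> U0" using x by (simp add: U0_def agree_def)
  qed
  ultimately have "P I0" unfolding P_def by blast
  then obtain I where I: "P I" and least: "\<And>J. P J \<Longrightarrow> card I \<le> card J"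
    using ex_has_least_nat[of P I0 card] by blast
  then obtain U n where U: "local_in X n U" "coherent X W U I" "contains_cuts X W U" "U \<subseteq> U0"
    unfolding P_def by blast
  have "finite I"
    using U(2) finite_positions[OF W] finite_subset unfolding coherent_def by blast
  have "\<exists>w\<in>W. piece I w 0 u" if "u \<in> return_words U" for u
  proof (rule ccontr)
    assume "\<not> ?thesis"
    then have "\<forall>w\<in>W. \<not> piece I w 0 u" by blast
    from discard_return_word[OF U(1-3) parses that this]
    obtain U' I' m' where U': "local_in X m' U'" "coherent X W U' I'" "contains_cuts X W U'" "U' \<subseteq> U" "I' \<subset> I"
      by blast
    have "P I'" unfolding P_def using U' U(4) by (meson order_trans)
    then show False
      using least[of I'] psubset_card_mono[OF \<open>finite I\<close> U'(5)] by simp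
  qed
  then obtain g where g: "\<And>u. u \<in> return_words U \<Longrightarrow> g u \<in> W \<and> piece I (g u) 0 u" by metis
  have inj: "inj_on g (return_words U)"
    using g piece_unique by (metis inj_onI)
  have img: "g ` return_words U \<subseteq> W" using g by blast
  show thesis
  proof
    show "local_in X n U" by (rule U)
    show "agree m y x" if "x \<in> U" for x using that U(4) by (auto simp: U0_def)
    show "finite (return_words U)" using inj img W by (meson inj_on_finite)
    show "card (return_words U) \<le> card W" using inj img W by (meson card_inj_on_le)
    show "\<exists>t. shift_by (- int t) x \<in> U" if x: "x \<in> X" for x
    proof -
      obtain f where f: "parse W x f" using parses x by blast
      obtain w e where "f 0 = (w, e)" by (cases "f 0")
      \<comment> \<open>Going back to the start of the factor that contains the origin reaches a
        cut.\<close>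
      then have "snd (shift_by (- int e) f 0) = 0" using parse_backward[OF f, of 0 w e e] by simp
      then have "shift_by (- int e) x \<in> U"
        using U(3) parse_shift_by[OF f] shift_by_mem[OF x] unfolding contains_cuts_def by blast
      then show ?thesis ..
    qed
    show "\<exists>u. return_word U x u" if xU: "x \<in> U" for x
    proof -
      have x: "x \<in> X" using xU U(1) by (auto simp: local_in_def)
      obtain f where f: "parse W x f" using parses x by blast
      obtain w e where we: "f 0 = (w, e)" by (cases "f 0")
      show ?thesis
        using return_word_exists[OF xU contains_cuts_shift[OF U(3) x f we]] parseD(2)[OF f we] by simp
    qed
  qed
qed

section \<open>Towers over return words\<close>

text \<open>These conditions place every point of \<open>X\<close> at a finite height above its last
  visit to \<open>U\<close>, so that the towers over return words exhaust \<open>X\<close>.\<close>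

definition tower_base :: "(int \<Rightarrow> 'a) set \<Rightarrow> bool" where
  "tower_base U \<longleftrightarrow> (\<exists>m. local_in X m U) \<and>
     (\<forall>x\<in>X. \<exists>t. shift_by (- int t) x \<in> U) \<and> (\<forall>x\<in>U. \<exists>u. return_word U x u)"

definition tower_atom :: "(int \<Rightarrow> 'a) set \<Rightarrow> 'a list \<Rightarrow> nat \<Rightarrow> (int \<Rightarrow> 'a) set" where
  "tower_atom U u j = shift_by (int j) ` {x \<in> X. return_word U x u}"

lemma tower_base_subset: "tower_base U \<Longrightarrow> U \<subseteq> X"
  unfolding tower_base_def local_in_def by blast

text \<open>If the heights differed, the base point belonging to the smaller height would be a visit
  to \<open>U\<close> strictly inside the other return word.\<close>

lemma tower_unique:
  assumes u: "return_word U x u" "j < length u" and v: "return_word U y v" "k < length v"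
    and eq: "shift_by (int j) x = shift_by (int k) y"
  shows "x = y \<and> j = k \<and> u = v"
proof -
  have le: "\<not> j < k" if "shift_by (int j) x = shift_by (int k) y" "return_word U x u" "return_word U y v" "k < length v"
    for j k x y u v
  proof
    assume "j < k"
    have "shift_by (int (k - j)) y = shift_by (- int j) (shift_by (int k) y)"
      using \<open>j < k\<close> by (simp add: of_nat_diff)
    also have "\<dots> = x" unfolding that(1)[symmetric] by simp
    finally have "shift_by (int (k - j)) y \<in> U" using that(2) by (simp add: return_word_def)
    then show False using return_word_length_le[OF that(3)] that(4) \<open>j < k\<close> by fastforce
  qed
  have jk: "j = k" using le[OF eq u(1) v] le[OF eq[symmetric] v(1) u] by simp
  have "shift_by (- int j) (shift_by (int j) x) = shift_by (- int j) (shift_by (int k) y)" using eq by simp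
  then have "x = y" using jk by simp
  then show ?thesis using jk return_word_unique u(1) v(1) by blast
qed

text \<open>Take the latest visit to \<open>U\<close> at a nonpositive time. If its return word
  ended at or before the origin, there would be a later such visit.\<close>

lemma in_tower:
  assumes U: "tower_base U" and x: "x \<in> X"
  obtains u j where "return_word U (shift_by (- int j) x) u" "j < length u"
proof -
  define j where "j = (LEAST t. shift_by (- int t) x \<in> U)"
  have j: "shift_by (- int j) x \<in> U"
    unfolding j_def using U x unfolding tower_base_def by (meson LeastI)
  then obtain u where u: "return_word U (shift_by (- int j) x) u"
    using U unfolding tower_base_def by blast
  have "j < length u"
  proof (rule ccontr)
    assume "\<not> j < length u"
    then have "shift_by (int (length u)) (shift_by (- int j) x) = shift_by (- int (j - length u)) x"
      by (simp add: of_nat_diff)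
    then have "shift_by (- int (j - length u)) x \<in> U" using u by (simp add: return_word_def)
    then have "j \<le> j - length u" unfolding j_def by (rule Least_le)
    moreover have "0 < length u" using u by (simp add: return_word_def)
    ultimately show False using \<open>\<not> j < length u\<close> by linarith
  qed
  with u show thesis by (rule that)
qed

lemma local_in_tower_atom:
  assumes "tower_base U" shows "\<exists>m. local_in X m (tower_atom U u j)"
proof -
  obtain m where "local_in X m U" using assms unfolding tower_base_def by blast
  from local_in_shift[OF local_in_return_word[OF this]] show ?thesis
    unfolding tower_atom_def by blast
qed

lemma tower_atoms_cover:
  assumes "tower_base U"
  shows "(\<Union>u\<in>return_words U. \<Union>j<length u. tower_atom U u j) = X"
proof
  show "X \<subseteq> (\<Union>u\<in>return_words U. \<Union>j<length u. tower_atom U u j)"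
  proof
    fix x assume x: "x \<in> X"
    obtain u j where u: "return_word U (shift_by (- int j) x) u" "j < length u"
      using in_tower[OF assms x] .
    have "x \<in> tower_atom U u j"
      unfolding tower_atom_def
      by (rule image_eqI[of _ _ "shift_by (- int j) x"]) (use u x in simp_all)
    moreover have "u \<in> return_words U" using u by (auto simp: return_words_def)
    ultimately show "x \<in> (\<Union>u\<in>return_words U. \<Union>j<length u. tower_atom U u j)" using u(2) by blast
  qed
qed (auto simp: tower_atom_def)

section \<open>The Kakutani-Rokhlin partition of a base, its return words being enumerated by
  \<open>r\<close>\<close>

context
  fixes U :: "(int \<Rightarrow> 'a) set" and r :: "nat \<Rightarrow> 'a list" and k :: nat
  assumes U: "tower_base U" and r: "bij_betw r {..<k} (return_words U)"
begin

lemma kr_atoms_eq: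
  "kr_atoms shift_map k (\<lambda>i. {x \<in> X. return_word U x (r i)}) (\<lambda>i. length (r i)) =
     {tower_atom U u j | u j. u \<in> return_words U \<and> j < length u}"
proof -
  have "return_words U = r ` {..<k}" using r by (simp add: bij_betw_def)
  then show ?thesis
    unfolding kr_atoms_def shift_map_funpow tower_atom_def by auto
qed

lemma kr_base_eq: "kr_base k (\<lambda>i. {x \<in> X. return_word U x (r i)}) = U"
proof -
  have "return_words U = r ` {..<k}" using r by (simp add: bij_betw_def)
  then have "(\<Union>i<k. {x \<in> X. return_word U x (r i)}) = (\<Union>u\<in>return_words U. {x \<in> X. return_word U x u})"
    by simp
  also have "\<dots> = U"
  proof
    show "U \<subseteq> (\<Union>u\<in>return_words U. {x \<in> X. return_word U x u})"
      using U tower_base_subset[OF U] unfolding tower_base_def return_words_def by blast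
  qed (auto simp: return_word_def)
  finally show ?thesis by (simp add: kr_base_def)
qed

lemma kr_partition_return_words:
  "kr_partition (subshift_space A X) shift_map k
     (\<lambda>i. {x \<in> X. return_word U x (r i)}) (\<lambda>i. length (r i))"
  unfolding kr_partition_def kr_atoms_eq
proof (intro conjI allI impI ballI)
  fix i assume "i < k"
  then have "r i \<in> return_words U" using r by (auto simp: bij_betw_def)
  then show "0 < length (r i)" by (auto simp: return_words_def return_word_def)
next
  fix P assume "P \<in> {tower_atom U u j |u j. u \<in> return_words U \<and> j < length u}"
  then obtain u j where P: "P = tower_atom U u j" "u \<in> return_words U" by blast
  obtain x where "return_word U x u" using P(2) by (auto simp: return_words_def)
  then show "P \<noteq> {}"
    using tower_base_subset[OF U] unfolding P(1) tower_atom_def return_word_def by blast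
  obtain m where "local_in X m P" using local_in_tower_atom[OF U] P(1) by blast
  then show "openin (subshift_space A X) P" "closedin (subshift_space A X) P"
    by (rule openin_local, rule closedin_local)
next
  show "disjoint_family_on (\<lambda>(i, j). (shift_map ^^ j) ` {x \<in> X. return_word U x (r i)})
          (SIGMA i:{..<k}. {..<length (r i)})"
    unfolding disjoint_family_on_def shift_map_funpow
  proof (intro ballI impI)
    fix p q assume p: "p \<in> (SIGMA i:{..<k}. {..<length (r i)})" and q: "q \<in> (SIGMA i:{..<k}. {..<length (r i)})"
      and "p \<noteq> q"
    obtain i j i' j' where ij: "p = (i, j)" "q = (i', j')" by (cases p, cases q)
    have lt: "i < k" "j < length (r i)" "i' < k" "j' < length (r i')" using p q ij by auto
    have "z \<notin> shift_by (int j') ` {x \<in> X. return_word U x (r i')}"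
      if z: "z \<in> shift_by (int j) ` {x \<in> X. return_word U x (r i)}" for z
    proof
      assume "z \<in> shift_by (int j') ` {x \<in> X. return_word U x (r i')}"
      with z obtain x y where "return_word U x (r i)" "return_word U y (r i')"
        "shift_by (int j) x = shift_by (int j') y" by blast
      then have "j = j'" "r i = r i'" using tower_unique lt by blast+
      then show False using r lt \<open>p \<noteq> q\<close> ij unfolding bij_betw_def inj_on_def by auto
    qed
    then show "(case p of (i, j) \<Rightarrow> shift_by (int j) ` {x \<in> X. return_word U x (r i)}) \<inter>
      (case q of (i, j) \<Rightarrow> shift_by (int j) ` {x \<in> X. return_word U x (r i)}) = {}"
      unfolding ij by auto
  qed
next
  have "\<Union> {tower_atom U u j |u j. u \<in> return_words U \<and> j < length u} =
    (\<Union>u\<in>return_words U. \<Union>j<length u. tower_atom U u j)" by blast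
  then show "\<Union> {tower_atom U u j |u j. u \<in> return_words U \<and> j < length u} = topspace (subshift_space A X)"
    using tower_atoms_cover[OF U] by simp
qed

end

section \<open>Refinement of towers and construction of the sequence of partitions\<close>

lemma same_return_word_agree:
  assumes V: "\<And>x y. x \<in> V \<Longrightarrow> y \<in> V \<Longrightarrow> agree m x y"
    and x: "return_word V x u" and y: "return_word V y u"
    and i: "- int m \<le> i" "i \<le> int m + int (length u)"
  shows "x i = y i"
proof -
  consider "i < 0" | "0 \<le> i" "i < int (length u)" | "int (length u) \<le> i" by linarith
  then show ?thesis
  proof cases
    case 1
    then show ?thesis using V[of x y] x y i unfolding agree_def return_word_def by simp
  next
    case 2
    then have "nat i < length u" "i = int (nat i)" by auto
    then show ?thesis using x y unfolding return_word_def by metis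
  next
    case 3
    have "agree m (shift_by (int (length u)) x) (shift_by (int (length u)) y)"
      using V x y unfolding return_word_def by blast
    moreover have "\<bar>i - int (length u)\<bar> \<le> int m" using 3 i by linarith
    ultimately have "shift_by (int (length u)) x (i - int (length u)) = shift_by (int (length u)) y (i - int (length u))"
      unfolding agree_def by blast
    then show ?thesis by simp
  qed
qed

text \<open>Points of \<open>V\<close> with return word \<open>u\<close> coincide up to
  \<open>m\<close> letters beyond both ends of \<open>u\<close>, because both ends are visits to
  \<open>V\<close>. As windows of size \<open>m\<close> decide membership in \<open>U\<close>, they
  meet \<open>U\<close> at the same times in between, and at height \<open>j\<close> they all lie in
  the same atom over \<open>U\<close>.\<close>

lemma tower_atom_refines:
  assumes U: "tower_base U" "local_in X m U" and V: "V \<subseteq> U"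
    "\<And>x y. x \<in> V \<Longrightarrow> y \<in> V \<Longrightarrow> agree m x y"
    and u: "u \<in> return_words V" "j < length u"
  shows "\<exists>v\<in>return_words U. \<exists>k<length v. tower_atom V u j \<subseteq> tower_atom U v k"
proof -
  obtain x where x: "return_word V x u" using u by (auto simp: return_words_def)
  then have xU: "x \<in> U" "shift_by (int (length u)) x \<in> U" using V(1) by (auto simp: return_word_def)
  then have xX: "x \<in> X" using U(2) by (auto simp: local_in_def)
  obtain v s where v: "return_word U (shift_by (- int s) (shift_by (int j) x)) v" "s < length v"
    using in_tower[OF U(1)] xX shift_by_mem by metis
  \<comment> \<open>The base point \<open>x\<close> is itself a visit to \<open>U\<close>, so the
    last visit before height \<open>j\<close> is not earlier than \<open>x\<close>.\<close>
  have "s \<le> j"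
  proof (rule ccontr)
    assume "\<not> s \<le> j"
    then have "shift_by (int (s - j)) (shift_by (- int s) (shift_by (int j) x)) = x"
      by (simp add: of_nat_diff)
    then show False using return_word_length_le[OF v(1), of "s - j"] xU v(2) \<open>\<not> s \<le> j\<close> by simp
  qed
  define t where "t = j - s"
  have j: "j = s + t" using \<open>s \<le> j\<close> by (simp add: t_def)
  have vt: "return_word U (shift_by (int t) x) v" using v(1) by (simp add: j)
  have "shift_by (int (length u - t)) (shift_by (int t) x) \<in> U" using xU u(2) j by (simp add: of_nat_diff)
  \<comment> \<open>The end of \<open>u\<close> is a visit to \<open>U\<close>, so \<open>v\<close>
    is completed within \<open>u\<close>.\<close>
  then have le: "t + length v \<le> length u" using return_word_length_le[OF vt, of "length u - t"] u(2) j by simp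
  have "tower_atom V u j \<subseteq> tower_atom U v s"
  proof
    fix z assume "z \<in> tower_atom V u j"
    then obtain y where y: "y \<in> X" "return_word V y u" "z = shift_by (int j) y"
      unfolding tower_atom_def by blast
    have "return_word U (shift_by (int t) x) v \<longleftrightarrow> return_word U (shift_by (int t) y) v"
    proof (rule return_word_cong[OF U(2)])
      show "shift_by (int t) x i = shift_by (int t) y i" if "- int m \<le> i" "i \<le> int m + int (length v)" for i
        using same_return_word_agree[OF V(2) x y(2), of "i + int t"] that le by simp
    qed (use xX y in simp_all)
    then have "return_word U (shift_by (int t) y) v" using vt by simp
    moreover have "z = shift_by (int s) (shift_by (int t) y)" by (simp add: y j)
    ultimately show "z \<in> tower_atom U v s"
      unfolding tower_atom_def by (intro image_eqI[of _ _ "shift_by (int t) y"]) (simp_all add: y(1))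
  qed
  moreover have "v \<in> return_words U" using v by (auto simp: return_words_def)
  ultimately show ?thesis using v(2) by blast
qed

lemma tower_atom_agree:
  assumes V: "\<And>x y. x \<in> V \<Longrightarrow> y \<in> V \<Longrightarrow> agree m x y" and j: "j < length u"
    and "x \<in> tower_atom V u j" "y \<in> tower_atom V u j"
  shows "agree m x y"
  unfolding agree_def
proof (intro allI impI)
  fix i assume i: "\<bar>i\<bar> \<le> int m"
  obtain a b where ab: "return_word V a u" "return_word V b u"
    and xy: "x = shift_by (int j) a" "y = shift_by (int j) b"
    using assms(3,4) unfolding tower_atom_def by blast
  show "x i = y i"
    using same_return_word_agree[OF V ab, of "i + int j"] i j by (simp add: xy)
qed

text \<open>Bases are chosen successively: given \<open>U\<close> with window \<open>m\<close>, the
  next base lies in the window cylinder of some \<open>y\<close> in \<open>U\<close>. It is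
  therefore inside \<open>U\<close>, and its points agree on that window, which yields refinement.
  Windows grow without bound, so the bases shrink to a point and the atoms generate the
  topology.\<close>

lemma finite_topological_rankI:
  assumes ne: "X \<noteq> {}" and min: "minimal_system (subshift_space A X) shift_map"
    and bases: "\<And>y m. y \<in> X \<Longrightarrow> \<exists>U. tower_base U \<and> (\<forall>x\<in>U. agree m y x) \<and>
      finite (return_words U) \<and> card (return_words U) \<le> K"
  shows "finite_topological_rank (subshift_space A X) shift_map"
proof -
  have base_ne: "U \<noteq> {}" if "tower_base U" for U
    using that ne unfolding tower_base_def by blast
  let ?P = "\<lambda>n (U, m). tower_base U \<and> local_in X m U \<and> n \<le> m \<and>
    finite (return_words U) \<and> card (return_words U) \<le> K"
  let ?Q = "\<lambda>n (U, m) (V, m' :: nat). \<exists>y\<in>U. \<forall>x\<in>V. agree m y x"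
  have "\<exists>F. \<forall>n. ?P n (F n) \<and> ?Q n (F n) (F (Suc n))"
  proof (rule dependent_nat_choice)
    obtain y where "y \<in> X" using ne by blast
    then obtain U where "tower_base U" "finite (return_words U)" "card (return_words U) \<le> K"
      using bases by blast
    moreover from this obtain m where "local_in X m U" unfolding tower_base_def by blast
    ultimately have "?P 0 (U, m)" by simp
    then show "\<exists>p. ?P 0 p" by blast
  next
    fix p n assume p: "?P n p"
    obtain U m where Um: "p = (U, m)" by (cases p)
    then obtain y where y: "y \<in> U" "y \<in> X" using p base_ne tower_base_subset by blast
    then obtain V where V: "tower_base V" "\<forall>x\<in>V. agree m y x" "finite (return_words V)" "card (return_words V) \<le> K"
      using bases by blast
    then obtain m' where "local_in X m' V" unfolding tower_base_def by blast
    \<comment> \<open>The window is enlarged artificially so that the sizes tend to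
      infinity.\<close>
    then have "local_in X (m' + Suc n) V" by (rule local_in_mono) simp
    then have "?P (Suc n) (V, m' + Suc n) \<and> ?Q n p (V, m' + Suc n)" using V y Um by auto
    then show "\<exists>q. ?P (Suc n) q \<and> ?Q n p q" by blast
  qed
  then obtain F where "\<forall>n. ?P n (F n) \<and> ?Q n (F n) (F (Suc n))" ..
  then have F: "?P n (F n) \<and> ?Q n (F n) (F (Suc n))" for n by (rule spec)
  define U where "U = (\<lambda>n. fst (F n))"
  define m where "m = (\<lambda>n. snd (F n))"
  have U: "tower_base (U n)" "local_in X (m n) (U n)" "n \<le> m n"
    "finite (return_words (U n))" "card (return_words (U n)) \<le> K" for n
    using F[of n] by (auto simp: U_def m_def split: prod.splits)
  have step: "\<exists>y\<in>U n. \<forall>x\<in>U (Suc n). agree (m n) y x" for n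
    using F[of n] by (auto simp: U_def m_def split: prod.splits)
  have agr: "agree (m n) x y" if "x \<in> U (Suc n)" "y \<in> U (Suc n)" for n x y
    using step[of n] that agree_trans agree_sym by metis
  have nested: "U (Suc n) \<subseteq> U n" for n
    using step[of n] U(2)[of n] tower_base_subset[OF U(1)] unfolding local_in_def by blast
  define k where "k = (\<lambda>n. card (return_words (U n)))"
  have "\<exists>r. bij_betw r {..<k n} (return_words (U n))" for n
    using ex_bij_betw_nat_finite[OF U(4)] unfolding k_def lessThan_atLeast0 .
  then obtain r where r: "\<And>n. bij_betw (r n) {..<k n} (return_words (U n))" by metis
  define B where "B = (\<lambda>n i. {x \<in> X. return_word (U n) x (r n i)})"
  define h where "h = (\<lambda>n i. length (r n i))"
  have part: "kr_partition (subshift_space A X) shift_map (k n) (B n) (h n)" for n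
    unfolding B_def h_def by (rule kr_partition_return_words[OF U(1) r])
  have atoms: "kr_atoms shift_map (k n) (B n) (h n) =
      {tower_atom (U n) u j | u j. u \<in> return_words (U n) \<and> j < length u}" for n
    unfolding B_def h_def by (rule kr_atoms_eq[OF U(1) r])
  have base: "kr_base (k n) (B n) = U n" for n
    unfolding B_def by (rule kr_base_eq[OF U(1) r])
  have refine: "\<exists>Q\<in>kr_atoms shift_map (k n) (B n) (h n). P \<subseteq> Q"
    if P: "P \<in> kr_atoms shift_map (k (Suc n)) (B (Suc n)) (h (Suc n))" for n P
  proof -
    obtain u j where u: "P = tower_atom (U (Suc n)) u j" "u \<in> return_words (U (Suc n))" "j < length u"
      using P unfolding atoms by blast
    show ?thesis
      using tower_atom_refines[OF U(1,2) nested agr u(2,3)] unfolding atoms u(1) by blast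
  qed
  have point: "\<exists>x. (\<Inter>n. U n) = {x}"
  proof -
    have "(\<Inter>n. U n) \<noteq> {}"
    proof (rule compact_space_imp_nest[OF compact_subshift_space])
      show "closedin (subshift_space A X) (U n)" for n using closedin_local U(2) by blast
      show "U n \<noteq> {}" for n using base_ne U(1) by blast
      show "decseq U" using nested by (rule decseq_SucI)
    qed
    moreover have "x = y" if "x \<in> (\<Inter>n. U n)" "y \<in> (\<Inter>n. U n)" for x y
    proof (rule agree_all_eq)
      show "agree n x y" for n
        using agree_mono[OF agr U(3)] that by blast
    qed
    ultimately show ?thesis by blast
  qed
  have generates: "topology_generated_by (\<Union>n. kr_atoms shift_map (k n) (B n) (h n)) = subshift_space A X"
    (is "topology_generated_by ?S = _")
    unfolding topology_eq
  proof (intro allI iffI)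
    fix T assume "openin (topology_generated_by ?S) T"
    then have gen: "generate_topology_on ?S T" by (rule openin_topology_generated_by)
    have "openin (subshift_space A X) P" if "P \<in> ?S" for P
      using that part unfolding kr_partition_def by blast
    from generate_topology_on_coarsest[OF istopology_openin this gen]
    show "openin (subshift_space A X) T" .
  next
    fix T assume T: "openin (subshift_space A X) T"
    \<comment> \<open>The points of an atom of level \<open>Suc n\<close> agree on the window of
      level \<open>n\<close>, whose size is at least \<open>n\<close>; hence the shift of the
      index.\<close>
    have "\<exists>P\<in>?S. x \<in> P \<and> P \<subseteq> T" if x: "x \<in> T" for x
    proof -
      have xX: "x \<in> X" using T x openin_iff by blast
      obtain n where n: "\<forall>y\<in>X. agree n x y \<longrightarrow> y \<in> T" using T x openin_iff by blast
      obtain u j where u: "u \<in> return_words (U (Suc n))" "j < length u" "x \<in> tower_atom (U (Suc n)) u j"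
        using tower_atoms_cover[OF U(1)[of "Suc n"]] xX by blast
      have "tower_atom (U (Suc n)) u j \<subseteq> T"
      proof
        fix y assume y: "y \<in> tower_atom (U (Suc n)) u j"
        then have "y \<in> X" by (auto simp: tower_atom_def)
        moreover have "agree n x y"
          by (rule agree_mono[OF tower_atom_agree[OF agr u(2,3) y] U(3)])
        ultimately show "y \<in> T" using n by blast
      qed
      moreover have "tower_atom (U (Suc n)) u j \<in> ?S"
        by (rule UN_I[of "Suc n"]) (use u in \<open>auto simp: atoms\<close>)
      ultimately show ?thesis using u(3) by blast
    qed
    then have "T = \<Union> {P \<in> ?S. P \<subseteq> T}" by blast
    moreover have "openin (topology_generated_by ?S) (\<Union> {P \<in> ?S. P \<subseteq> T})"
      by (rule openin_Union) (auto intro: topology_generated_by_Basis)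
    ultimately show "openin (topology_generated_by ?S) T" by simp
  qed
  have few: "k n \<le> K" for n using U(5) by (simp add: k_def)
  show ?thesis
    unfolding finite_topological_rank_def
    by (intro conjI compact_subshift_space totally_disconnected_subshift_space metrizable_subshift_space
          min exI[of _ k] exI[of _ B] exI[of _ h] allI ballI part refine generates exI[of _ K])
      (use nested point few in \<open>simp_all add: base\<close>)
qed

section \<open>Systems covered by few words\<close>

text \<open>Stated for finite factors only, so that it can be read off from the language;
  \<open>parse_exists\<close> upgrades it to factorizations of points when \<open>W\<close> is
  finite and consists of nonempty words.\<close>

definition covered_by :: "'a list set \<Rightarrow> bool" where
  "covered_by W \<longleftrightarrow> (\<forall>x\<in>X. \<forall>i j. \<exists>ws\<in>lists W. sublist (map x [i..j]) (concat ws))"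

text \<open>A point \<open>y\<close> of a closed invariant set factors over words that all contain a
  given central factor of \<open>x\<close>. Shifts of \<open>y\<close> thus approximate
  \<open>x\<close> on every window, and closedness brings \<open>x\<close> into the set.\<close>

lemma minimal_systemI:
  assumes ne: "X \<noteq> {}"
    and cover: "\<And>x m. x \<in> X \<Longrightarrow> \<exists>W. finite W \<and> [] \<notin> W \<and>
      (\<forall>w\<in>W. sublist (map x [- int m..int m]) w) \<and> covered_by W"
  shows "minimal_system (subshift_space A X) shift_map"
  unfolding minimal_system_def
proof (intro conjI allI impI)
  show "topspace (subshift_space A X) \<noteq> {}" using ne by simp
  show "homeomorphic_map (subshift_space A X) (subshift_space A X) shift_map"
    by (rule homeomorphic_shift_map)
  fix C assume C: "closedin (subshift_space A X) C \<and> shift_map ` C = C"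
  have fw: "shift_by (int n) y \<in> C" if "y \<in> C" for n y
  proof (induction n)
    case (Suc n)
    have "shift_by (int (Suc n)) y = shift_map (shift_by (int n) y)" by (simp add: shift_map_eq)
    then show ?case using Suc C by blast
  qed (simp add: that)
  have "x \<in> C" if y: "y \<in> C" and x: "x \<in> X" for x y
  proof (rule ccontr)
    assume "x \<notin> C"
    moreover have "openin (subshift_space A X) (X - C)" using C by (auto simp: closedin_def)
    ultimately obtain m where m: "\<forall>x'\<in>X. agree m x x' \<longrightarrow> x' \<in> X - C"
      using x unfolding openin_iff by blast
    obtain W where W: "finite W" "[] \<notin> W" "\<forall>w\<in>W. sublist (map x [- int m..int m]) w" "covered_by W"
      using cover[OF x] by blast
    have yX: "y \<in> X" using y C closedin_subset by fastforce
    then obtain f where f: "parse W y f"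
      using parse_exists[OF W(1,2)] W(4) unfolding covered_by_def by blast
    obtain w0 e where "f 0 = (w0, e)" by (cases "f 0")
    then have "snd (f (int (length w0 - e))) = 0" using parse_next[OF f, of 0] by simp
    \<comment> \<open>A cut at a nonnegative place is taken because \<open>fw\<close> supplies only
      nonnegative shifts.\<close>
    then obtain i w where i: "f (int i) = (w, 0)" by (metis prod.collapse)
    then obtain p s where w: "w = p @ map x [- int m..int m] @ s"
      using W(3) parseD(1)[OF f] unfolding sublist_def by blast
    \<comment> \<open>The summand \<open>m\<close> moves from the beginning of the occurrence to its
      centre.\<close>
    have "agree m x (shift_by (int (i + length p + m)) y)"
      unfolding agree_def
    proof (intro allI impI)
      fix j assume j: "\<bar>j\<bar> \<le> int m"
      define t where "t = nat (j + int m)"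
      have t: "t < length (map x [- int m..int m])" "j = int t - int m" using j by (auto simp: t_def)
      have "f (int i + int (length p + t)) = (w, 0 + (length p + t))"
        using t(1) by (intro parse_forward[OF f i]) (simp add: w)
      then have "y (int i + int (length p + t)) = w ! (length p + t)"
        using parseD(3)[OF f] by simp
      also have "\<dots> = map x [- int m..int m] ! t"
        using t(1) by (simp only: w nth_append_length_plus nth_append_left)
      also have "\<dots> = x j" using t j by (simp add: nth_upto)
      finally show "x j = shift_by (int (i + length p + m)) y j" using t(2) by (simp add: add_ac)
    qed
    then show False using m fw[OF y] shift_by_mem[OF yX] by blast
  qed
  then show "C = {} \<or> C = topspace (subshift_space A X)"
    using closedin_subset C by fastforce
qed

text \<open>Cutting every word of \<open>W\<close> at the marker \<open>u @ v\<close> and gluing the halves across the old cuts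
  gives words that all begin with \<open>v\<close> and end with \<open>u\<close>.\<close>

lemma recut:
  assumes W: "finite W" "card W \<le> K" "covered_by W"
    and marker: "\<forall>w\<in>W. sublist (u @ v) w" and v: "v \<noteq> []"
  obtains V where "finite V" "card V \<le> K * K" "[] \<notin> V" "covered_by V"
    "\<forall>w\<in>V. \<exists>t. w = v @ t" "\<forall>w\<in>V. \<exists>t. w = t @ u"
proof -
  have "\<exists>p s. w = (p @ u) @ (v @ s)" if "w \<in> W" for w
    using marker that by (auto simp: sublist_def)
  then obtain p s where ps: "\<And>w. w \<in> W \<Longrightarrow> w = (p w @ u) @ (v @ s w)" by metis
  \<comment> \<open>The new word reaches from the marker of \<open>w\<close> across the old cut to
    the marker of \<open>w'\<close>.\<close>
  define g where "g = (\<lambda>(w, w'). (v @ s w) @ (p w' @ u))"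
  define V where "V = g ` (W \<times> W)"
  have regroup: "\<exists>vs\<in>lists V. concat vs = (v @ s a) @ concat ws @ (p b @ u)"
    if "ws \<in> lists W" "a \<in> W" "b \<in> W" for ws a b
    using that(1,2)
  proof (induction ws arbitrary: a)
    case Nil
    then have "g (a, b) \<in> V" using that(3) by (auto simp: V_def)
    then show ?case by (intro bexI[of _ "[g (a, b)]"]) (auto simp: g_def)
  next
    case (Cons w ws)
    note w = Cons.hyps(1)
    obtain vs where vs: "vs \<in> lists V" "concat vs = (v @ s w) @ concat ws @ (p b @ u)"
      using Cons.IH[OF w] by blast
    have "g (a, w) \<in> V" using Cons.prems w by (auto simp: V_def)
    moreover have "concat (w # ws) = (p w @ u) @ (v @ s w) @ concat ws"
      using ps[OF w] by simp
    ultimately show ?case using vs by (intro bexI[of _ "g (a, w) # vs"]) (auto simp: g_def)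
  qed
  show thesis
  proof
    show "finite V" using W(1) by (simp add: V_def)
    have "card V \<le> card (W \<times> W)" unfolding V_def using W(1) by (intro card_image_le) simp
    also have "\<dots> \<le> K * K" using W(2) by (simp add: card_cartesian_product mult_le_mono)
    finally show "card V \<le> K * K" .
    show "[] \<notin> V" using v by (auto simp: V_def g_def)
    show "\<forall>w\<in>V. \<exists>t. w = v @ t" "\<forall>w\<in>V. \<exists>t. w = t @ u"
      by (auto simp: V_def g_def)
    show "covered_by V"
      unfolding covered_by_def
    proof (intro ballI allI)
      fix x i j assume "x \<in> X"
      then obtain ws where ws: "ws \<in> lists W" "sublist (map x [i..j]) (concat ws)"
        using W(3) unfolding covered_by_def by blast
      show "\<exists>vs\<in>lists V. sublist (map x [i..j]) (concat vs)"
      proof (cases ws)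
        case Nil
        then show ?thesis using ws(2) by (intro bexI[of _ "[]"]) auto
      next
        case (Cons a ws')
        then have "a \<in> W" using ws by simp
        \<comment> \<open>Half of \<open>a\<close> is attached at either end as padding, so that the
          old concatenation survives whole inside one of new words.\<close>
        then obtain vs where vs: "vs \<in> lists V" "concat vs = (v @ s a) @ concat ws @ (p a @ u)"
          using regroup[OF ws(1)] by blast
        have "sublist (concat ws) (concat vs)" unfolding vs(2) sublist_def by blast
        then show ?thesis using vs(1) ws(2) sublist_order.order_trans by blast
      qed
    qed
  qed
qed

text \<open>The central factor of \<open>y\<close> is the marker, split at the origin. Recutting
  squares the number of words, hence the bound \<open>K * K\<close>, and
  \<open>few_return_words\<close> passes this bound on to the towers.\<close>

theorem finite_topological_rank_of_covers:
  assumes ne: "X \<noteq> {}"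
    and cover: "\<And>x m. x \<in> X \<Longrightarrow> \<exists>W. finite W \<and> card W \<le> K \<and> [] \<notin> W \<and>
      (\<forall>w\<in>W. sublist (map x [- int m..int m]) w) \<and> covered_by W"
  shows "finite_topological_rank (subshift_space A X) shift_map"
proof (rule finite_topological_rankI[OF ne])
  show "minimal_system (subshift_space A X) shift_map"
    by (rule minimal_systemI[OF ne]) (use cover in \<open>meson\<close>)
  fix y m assume y: "y \<in> X"
  obtain W where W: "finite W" "card W \<le> K" "covered_by W"
    "\<forall>w\<in>W. sublist (map y [- int m..int m]) w"
    using cover[OF y] by blast
  have split: "map y [- int m..int m] = map y [- int m..- 1] @ map y [0..int m]"
    using upto_split1[of "- int m" 0 "int m"] by simp
  have ne0: "map y [0..int m] \<noteq> []" by simp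
  obtain V where V: "finite V" "card V \<le> K * K" "[] \<notin> V" "covered_by V"
    "\<forall>w\<in>V. \<exists>t. w = map y [0..int m] @ t"
    "\<forall>w\<in>V. \<exists>t. w = t @ map y [- int m..- 1]"
    using recut[OF W(1-3) W(4)[unfolded split] ne0] .
  have parses: "\<forall>x\<in>X. \<exists>f. parse V x f"
    using parse_exists[OF V(1,3)] V(4) unfolding covered_by_def by blast
  obtain U n where U: "local_in X n U" "\<And>x. x \<in> U \<Longrightarrow> agree m y x"
    "finite (return_words U)" "card (return_words U) \<le> card V"
    "\<And>x. x \<in> X \<Longrightarrow> \<exists>t. shift_by (- int t) x \<in> U" "\<And>x. x \<in> U \<Longrightarrow> \<exists>u. return_word U x u"
    by (rule few_return_words[OF V(1) parses y V(5,6)]) blast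
  then have "tower_base U" unfolding tower_base_def by blast
  then show "\<exists>U. tower_base U \<and> (\<forall>x\<in>U. agree m y x) \<and>
      finite (return_words U) \<and> card (return_words U) \<le> K * K"
    using U V(2) by (meson order_trans)
qed

end

section \<open>S-adic subshifts\<close>

lemma map_shift_by: "map (shift_by t x) [i..j] = map x [i + t..j + t]"
  by (rule nth_equalityI) (auto simp: nth_upto add_ac)

section \<open>Conjugacy by renaming letters\<close>

lemma continuous_map_agree:
  assumes "symbolic_system A X" "symbolic_system B Y" "\<phi> ` X \<subseteq> Y"
    and "\<And>m x y. agree m x y \<Longrightarrow> agree m (\<phi> x) (\<phi> y)"
  shows "continuous_map (subshift_space A X) (subshift_space B Y) \<phi>"
proof -
  interpret X: symbolic_system A X by fact
  interpret Y: symbolic_system B Y by fact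
  show ?thesis
    unfolding continuous_map_def
  proof (intro conjI allI impI)
    fix S assume S: "openin (subshift_space B Y) S"
    show "openin (subshift_space A X) {x \<in> topspace (subshift_space A X). \<phi> x \<in> S}"
      unfolding X.openin_iff X.topspace_subshift_space
    proof (intro conjI ballI)
      fix x assume "x \<in> {x \<in> X. \<phi> x \<in> S}"
      then obtain m where "\<forall>y\<in>Y. agree m (\<phi> x) y \<longrightarrow> y \<in> S" using S Y.openin_iff by blast
      then have "\<forall>y\<in>X. agree m x y \<longrightarrow> y \<in> {x \<in> X. \<phi> x \<in> S}" using assms(3,4) by blast
      then show "\<exists>m. \<forall>y\<in>X. agree m x y \<longrightarrow> y \<in> {x \<in> X. \<phi> x \<in> S}" ..
    qed blast
  qed (use assms(3) in auto)
qed

text \<open>Renaming acts letter by letter, so it and the inverse renaming \<open>r\<close> preserve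
  agreement on windows and commute with the shift.\<close>

lemma relabel_subshift:
  assumes X: "subshift A X" and g: "inj_on g A"
  shows "subshift (g ` A) ((\<circ>) g ` X)"
    and "topologically_conjugate (subshift_space A X) shift_map
           (subshift_space (g ` A) ((\<circ>) g ` X)) shift_map"
proof -
  interpret symbolic_system A X by standard (rule X)
  define r where "r = inv_into A g"
  have r: "r (g a) = a" if "a \<in> A" for a using g that by (simp add: r_def)
  have rx: "r \<circ> (g \<circ> x) = x" if "x \<in> X" for x using r letter[OF that] by (auto simp: fun_eq_iff)
  let ?Y = "(\<circ>) g ` X"
  have agree_comp: "agree m (k \<circ> x) (k \<circ> y)" if "agree m x y" for m x y and k :: "'x \<Rightarrow> 'y"
    using that by (simp add: agree_def)
  have "closedin (full_shift (g ` A)) ?Y"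
    unfolding closedin_full_shift
  proof (intro conjI ballI impI)
    show "?Y \<subseteq> topspace (full_shift (g ` A))" using letter by (auto simp: topspace_full_shift)
    fix y assume y: "y \<in> topspace (full_shift (g ` A))" "\<forall>m. \<exists>z\<in>?Y. agree m y z"
    have "r \<circ> y \<in> X"
    proof (rule limit_mem)
      fix m
      obtain x where "x \<in> X" "agree m y (g \<circ> x)" using y(2) by blast
      then have "agree m (r \<circ> y) x" using agree_comp[of m y "g \<circ> x" r] rx by simp
      then show "\<exists>z\<in>X. agree m (r \<circ> y) z" using \<open>x \<in> X\<close> by blast
    qed
    moreover have "y = g \<circ> (r \<circ> y)"
      using y(1) by (auto simp: topspace_full_shift r_def fun_eq_iff f_inv_into_f image_subset_iff)
    ultimately show "y \<in> ?Y" by blast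
  qed
  moreover have "shift_map ` ?Y = ?Y"
  proof -
    have "shift_map (g \<circ> x) = g \<circ> shift_map x" for x by (simp add: shift_map_def fun_eq_iff)
    then have "shift_map ` ?Y = (\<circ>) g ` (shift_map ` X)" by (simp add: image_image)
    then show ?thesis using X by (simp add: subshift_def)
  qed
  ultimately show Y: "subshift (g ` A) ?Y" using finite_alphabet by (simp add: subshift_def)
  have "homeomorphic_maps (subshift_space A X) (subshift_space (g ` A) ?Y) ((\<circ>) g) ((\<circ>) r)"
    unfolding homeomorphic_maps_def
  proof (intro conjI ballI)
    have sym: "symbolic_system A X" "symbolic_system (g ` A) ?Y"
      using X Y by (simp_all add: symbolic_system_def)
    show "continuous_map (subshift_space A X) (subshift_space (g ` A) ?Y) ((\<circ>) g)"
      using sym by (rule continuous_map_agree) (auto intro: agree_comp)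
    show "continuous_map (subshift_space (g ` A) ?Y) (subshift_space A X) ((\<circ>) r)"
      using sym(2,1) by (rule continuous_map_agree) (auto simp: rx intro: agree_comp)
    have "topspace (subshift_space (g ` A) ?Y) = ?Y"
      using sym(2) by (rule symbolic_system.topspace_subshift_space)
    then show "g \<circ> (r \<circ> y) = y" if "y \<in> topspace (subshift_space (g ` A) ?Y)" for y
      using that rx by auto
  qed (simp add: rx)
  then have "homeomorphic_map (subshift_space A X) (subshift_space (g ` A) ?Y) ((\<circ>) g)"
    using homeomorphic_maps_map by blast
  moreover have "\<forall>x\<in>topspace (subshift_space A X). g \<circ> shift_map x = shift_map (g \<circ> x)"
    by (simp add: shift_map_def fun_eq_iff)
  ultimately show "topologically_conjugate (subshift_space A X) shift_map
      (subshift_space (g ` A) ?Y) shift_map"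
    unfolding topologically_conjugate_def by blast
qed

section \<open>Compositions of the morphisms and covers by the words of one level\<close>

lemma composed_same [simp]: "composed \<tau> n n w = w"
  by (simp add: composed_def)

lemma composed_append: "composed \<tau> m n (u @ v) = composed \<tau> m n u @ composed \<tau> m n v"
proof -
  have "foldr (\<lambda>i. extend_morphism (\<tau> i)) is (u @ v) =
      foldr (\<lambda>i. extend_morphism (\<tau> i)) is u @ foldr (\<lambda>i. extend_morphism (\<tau> i)) is v" for "is"
    by (induction "is") (auto simp: extend_morphism_def)
  then show ?thesis by (simp add: composed_def)
qed

lemma composed_Nil [simp]: "composed \<tau> m n [] = []"
  using composed_append[of \<tau> m n "[]" "[]"] by simp

lemma composed_concat: "composed \<tau> m n w = concat (map (\<lambda>a. composed \<tau> m n [a]) w)"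
proof (induction w)
  case (Cons a w)
  then show ?case using composed_append[of \<tau> m n "[a]" w] by simp
qed simp

lemma composed_composed:
  assumes "k \<le> m" "m \<le> n"
  shows "composed \<tau> k m (composed \<tau> m n w) = composed \<tau> k n w"
proof -
  have "[k..<n] = [k..<m] @ [m..<n]" using assms by (metis le_add_diff_inverse upt_add_eq_append)
  then show ?thesis by (simp add: composed_def)
qed

lemma sublist_composed:
  assumes "a \<in> set w" shows "sublist (composed \<tau> m n [a]) (composed \<tau> m n w)"
proof -
  obtain u v where "w = u @ [a] @ v" using split_list[OF assms] by auto
  then have "composed \<tau> m n w = composed \<tau> m n u @ composed \<tau> m n [a] @ composed \<tau> m n v"
    by (simp only: composed_append)
  then show ?thesis unfolding sublist_def by blast
qed

lemma composed_Suc: "m \<le> n \<Longrightarrow> composed \<tau> m (Suc n) w = composed \<tau> m n (extend_morphism (\<tau> n) w)"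
  by (simp add: composed_def)

locale s_adic =
  fixes A :: "nat \<Rightarrow> 'a set" and \<tau> :: "nat \<Rightarrow> 'a \<Rightarrow> 'a list"
  assumes directive: "directive_sequence A \<tau>"
begin

lemma finite_letters: "finite (A n)"
  using directive by (simp add: directive_sequence_def)

lemma composed_lists_nonempty:
  assumes "m \<le> n" "w \<in> lists (A n)"
  shows "composed \<tau> m n w \<in> lists (A m) \<and> (w \<noteq> [] \<longrightarrow> composed \<tau> m n w \<noteq> [])"
  using assms
proof (induction n arbitrary: w rule: dec_induct)
  case (step n)
  have \<tau>: "\<tau> n a \<in> lists (A n)" "\<tau> n a \<noteq> []" if "a \<in> A (Suc n)" for a
    using directive that by (auto simp: directive_sequence_def)
  have "extend_morphism (\<tau> n) w \<in> lists (A n)"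
    using step.prems \<tau>(1) by (fastforce simp: extend_morphism_def)
  moreover have "w \<noteq> [] \<longrightarrow> extend_morphism (\<tau> n) w \<noteq> []"
    using step.prems \<tau>(2) by (cases w) (auto simp: extend_morphism_def)
  ultimately show ?case using step.IH step.hyps by (auto simp: composed_Suc)
qed auto

abbreviation X :: "(int \<Rightarrow> 'a) set" where
  "X \<equiv> s_adic_subshift A \<tau> 0"

lemma s_adic_subshift_subshift: "subshift (A 0) X"
  unfolding subshift_def
proof (intro conjI)
  show "finite (A 0)" by (rule finite_letters)
  show "closedin (full_shift (A 0)) X"
    unfolding closedin_full_shift
  proof (intro conjI ballI impI)
    show "X \<subseteq> topspace (full_shift (A 0))" by (auto simp: s_adic_subshift_def topspace_full_shift)
    fix x assume x: "x \<in> topspace (full_shift (A 0))" "\<forall>m. \<exists>y\<in>X. agree m x y"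
    have "map x [i..j] \<in> s_adic_language A \<tau> 0" for i j
    proof -
      obtain y where y: "y \<in> X" "agree (nat (\<bar>i\<bar> + \<bar>j\<bar>)) x y" using x(2) by blast
      have "map x [i..j] = map y [i..j]"
        using y(2) by (auto simp: agree_def)
      moreover have "map y [i..j] \<in> s_adic_language A \<tau> 0" using y(1) by (simp add: s_adic_subshift_def)
      ultimately show ?thesis by (simp only:)
    qed
    then show "x \<in> X" using x(1) by (simp add: s_adic_subshift_def topspace_full_shift)
  qed
  have sh: "shift_by t x \<in> X" if "x \<in> X" for t x
    using that unfolding s_adic_subshift_def by (auto simp: map_shift_by)
  have "x \<in> shift_map ` X" if "x \<in> X" for x
    using sh[OF that, of "- 1"] by (intro image_eqI[of _ _ "shift_by (- 1) x"]) (simp_all add: shift_map_eq)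
  then show "shift_map ` X = X" using sh by (auto simp: shift_map_eq)
qed

text \<open>Long factors of a point are not factors of the finitely many words \<open>\<tau>\<^bsub>[0,N)\<^esub>(a)\<close>
  with \<open>N < n\<close>.\<close>

lemma factor_at_high_level:
  assumes x: "x \<in> X"
  shows "\<exists>N\<ge>n. \<exists>a\<in>A N. sublist (map x [i..j]) (composed \<tau> 0 N [a])"
proof -
  define S where "S = (\<Union>N<n. (\<lambda>a. length (composed \<tau> 0 N [a])) ` A N)"
  have "finite S" using finite_letters by (auto simp: S_def)
  define M where "M = Max (insert 0 S)"
  \<comment> \<open>The extended factor has more than \<open>M\<close> letters;
    \<open>max i j\<close> ensures this also when \<open>i > j\<close>.\<close>
  define j' where "j' = max i j + int M"
  have "map x [i..j'] \<in> s_adic_language A \<tau> 0" using x by (simp add: s_adic_subshift_def)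
  then obtain N a where N: "a \<in> A N" "sublist (map x [i..j']) (composed \<tau> 0 N [a])"
    by (auto simp: s_adic_language_def)
  have "n \<le> N"
  proof (rule ccontr)
    assume "\<not> n \<le> N"
    then have "length (composed \<tau> 0 N [a]) \<in> S" using N(1) by (auto simp: S_def)
    then have "length (composed \<tau> 0 N [a]) \<le> M" unfolding M_def using \<open>finite S\<close> by simp
    moreover have "M < length (map x [i..j'])" by (simp add: j'_def)
    ultimately show False using sublist_length_le[OF N(2)] by simp
  qed
  moreover have "sublist (map x [i..j]) (map x [i..j'])"
  proof (cases "i \<le> j")
    case True
    then have "[i..j'] = [i..j] @ [j + 1..j']" by (intro upto_split2) (auto simp: j'_def)
    then show ?thesis by (simp add: sublist_append_rightI)
  qed simp
  ultimately show ?thesis using N sublist_order.order_trans by blast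
qed

definition level_words :: "nat \<Rightarrow> 'a list set" where
  "level_words n = (\<lambda>a. composed \<tau> 0 n [a]) ` A n"

text \<open>For \<open>N \<ge> n\<close> the word of level \<open>N\<close> splits into the images
  of the letters of \<open>composed \<tau> n N [a]\<close>, which are words of level
  \<open>n\<close>.\<close>

lemma level_words_cover:
  assumes "x \<in> X"
  shows "\<exists>ws\<in>lists (level_words n). sublist (map x [i..j]) (concat ws)"
proof -
  obtain N a where N: "n \<le> N" "a \<in> A N" "sublist (map x [i..j]) (composed \<tau> 0 N [a])"
    using factor_at_high_level[OF assms] by blast
  define ws where "ws = map (\<lambda>b. composed \<tau> 0 n [b]) (composed \<tau> n N [a])"
  have "composed \<tau> n N [a] \<in> lists (A n)" using composed_lists_nonempty[OF N(1)] N(2) by simp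
  then have "ws \<in> lists (level_words n)" by (auto simp: ws_def level_words_def)
  moreover have "concat ws = composed \<tau> 0 N [a]"
    using composed_concat[of \<tau> 0 n "composed \<tau> n N [a]"] composed_composed[OF _ N(1), of 0 \<tau>]
    by (simp add: ws_def)
  ultimately show ?thesis using N(3) by metis
qed

text \<open>The factor occurs in the image of one letter \<open>a\<close> of some level
  \<open>M\<close>. Primitivity puts \<open>a\<close> into the image of every letter of level
  \<open>N\<close>, and every word of a later level contains the image of such a letter.\<close>

lemma eventually_factor_of_level_words:
  assumes prim: "primitive_directive A \<tau>" and x: "x \<in> X"
  shows "\<exists>N. \<forall>n\<ge>N. \<forall>w\<in>level_words n. sublist (map x [i..j]) w"
proof -
  \<comment> \<open>A level \<open>M \<ge> 1\<close> is requested because primitivity speaks only of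
    levels from 1 on.\<close>
  obtain M a where M: "1 \<le> M" "a \<in> A M" "sublist (map x [i..j]) (composed \<tau> 0 M [a])"
    using factor_at_high_level[OF x] by blast
  obtain N where N: "M \<le> N" "\<forall>b\<in>A N. \<forall>c\<in>A M. incidence_matrix (\<lambda>c. composed \<tau> M N [c]) b c > 0"
    using prim M(1) unfolding primitive_directive_def by blast
  have "sublist (map x [i..j]) (composed \<tau> 0 n [c])" if n: "N \<le> n" and c: "c \<in> A n" for n c
  proof -
    have "composed \<tau> N n [c] \<in> lists (A N)" "composed \<tau> N n [c] \<noteq> []"
      using composed_lists_nonempty[OF n, of "[c]"] c by auto
    then obtain b where b: "b \<in> set (composed \<tau> N n [c])" "b \<in> A N" by (cases "composed \<tau> N n [c]") auto
    have "count_list (composed \<tau> M N [b]) a > 0" using N(2) b(2) M(2) by (auto simp: incidence_matrix_def)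
    then have "a \<in> set (composed \<tau> M N [b])" by (metis count_list_0_iff less_irrefl)
    then have "sublist (composed \<tau> 0 M [a]) (composed \<tau> 0 N [b])"
      using sublist_composed composed_composed[OF _ N(1), of 0 \<tau> "[b]"] by (metis le0)
    moreover have "sublist (composed \<tau> 0 N [b]) (composed \<tau> 0 n [c])"
      using sublist_composed[OF b(1)] composed_composed[OF _ n, of 0 \<tau> "[c]"] by (metis le0)
    ultimately show ?thesis using M(3) sublist_order.order_trans by blast
  qed
  then show ?thesis unfolding level_words_def by blast
qed

end

text \<open>Otherwise the values would eventually be at least \<open>Suc K\<close>, and so would the
  lower limit. Infinitely many small alphabets suffice, since covers may be taken at arbitrarily
  high levels.\<close>

lemma frequently_le_of_liminf:
  fixes f :: "nat \<Rightarrow> nat"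
  assumes "liminf (\<lambda>n. enat (f n)) < \<infinity>"
  shows "\<exists>K. \<forall>N. \<exists>n\<ge>N. f n \<le> K"
proof -
  obtain K where K: "liminf (\<lambda>n. enat (f n)) = enat K" using assms by (cases "liminf (\<lambda>n. enat (f n))") auto
  have "\<exists>n\<ge>N. f n \<le> K" for N
  proof (rule ccontr)
    assume "\<not> ?thesis"
    then have "\<forall>n\<ge>N. enat (Suc K) \<le> enat (f n)" by (simp add: Suc_le_eq) (meson not_le)
    then have "\<forall>\<^sub>F n in sequentially. enat (Suc K) \<le> enat (f n)"
      unfolding eventually_sequentially by blast
    then have "enat (Suc K) \<le> liminf (\<lambda>n. enat (f n))" by (rule Liminf_bounded)
    then show False by (simp add: K)
  qed
  then show ?thesis by blast
qed

theorem corollary1p3: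
  fixes A :: "nat \<Rightarrow> 'a set" and \<tau> :: "nat \<Rightarrow> 'a \<Rightarrow> 'a list"
  assumes "directive_sequence A \<tau>"
    and "primitive_directive A \<tau>"
    and "s_adic_subshift A \<tau> 0 \<noteq> {}"
    and "liminf (\<lambda>n. enat (card (A n))) < \<infinity>"
  shows "\<exists>(B :: nat set) (Y :: (int \<Rightarrow> nat) set).
           subshift B Y \<and>
           topologically_conjugate (subshift_space (A 0) (s_adic_subshift A \<tau> 0)) shift_map
             (subshift_space B Y) shift_map \<and>
           finite_topological_rank (subshift_space B Y) shift_map"
proof -
  interpret s_adic A \<tau> by standard (rule assms(1))
  obtain K where K: "\<forall>N. \<exists>n\<ge>N. card (A n) \<le> K" using frequently_le_of_liminf[OF assms(4)] by blast
  \<comment> \<open>The conjugate subshift has natural numbers as letters; \<open>g\<close> renames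
    the finite alphabet of level 0.\<close>
  obtain g :: "'a \<Rightarrow> nat" where g: "inj_on g (A 0)"
    using finite_imp_inj_to_nat_seg[OF finite_letters] by blast
  define B where "B = g ` A 0"
  define Y where "Y = (\<circ>) g ` X"
  have Y: "subshift B Y"
    "topologically_conjugate (subshift_space (A 0) X) shift_map (subshift_space B Y) shift_map"
    using relabel_subshift[OF s_adic_subshift_subshift g] by (simp_all add: B_def Y_def)
  interpret Y: symbolic_system B Y by standard (rule Y)
  have sublist_map: "sublist (map g u) (map g v)" if "sublist u v" for u v
    using that unfolding sublist_def by (metis map_append)
  have "finite_topological_rank (subshift_space B Y) shift_map"
  proof (rule Y.finite_topological_rank_of_covers)
    show "Y \<noteq> {}" using assms(3) by (simp add: Y_def)
    fix y m assume "y \<in> Y"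
    then obtain x where x: "x \<in> X" "y = g \<circ> x" by (auto simp: Y_def)
    obtain N where N: "\<forall>n\<ge>N. \<forall>w\<in>level_words n. sublist (map x [- int m..int m]) w"
      using eventually_factor_of_level_words[OF assms(2) x(1)] by blast
    \<comment> \<open>A level late enough for all its words to contain the factor of
      \<open>x\<close>, yet with at most \<open>K\<close> letters.\<close>
    obtain n where n: "n \<ge> N" "card (A n) \<le> K" using K by blast
    define W where "W = map g ` level_words n"
    have fin: "finite (level_words n)" using finite_letters by (simp add: level_words_def)
    have "card W \<le> card (level_words n)" unfolding W_def by (rule card_image_le[OF fin])
    also have "\<dots> \<le> card (A n)" unfolding level_words_def by (rule card_image_le[OF finite_letters])
    finally have "card W \<le> K" using n(2) by simp
    moreover have "composed \<tau> 0 n [a] \<noteq> []" if "a \<in> A n" for a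
      using composed_lists_nonempty[of 0 n "[a]"] that by simp
    then have "[] \<notin> W" by (force simp: W_def level_words_def)
    moreover have "\<forall>w\<in>W. sublist (map y [- int m..int m]) w"
    proof
      fix w assume "w \<in> W"
      then obtain w' where w': "w' \<in> level_words n" "w = map g w'" by (auto simp: W_def)
      then have "sublist (map g (map x [- int m..int m])) (map g w')" using N n(1) sublist_map by blast
      then show "sublist (map y [- int m..int m]) w" by (simp add: x(2) w'(2))
    qed
    moreover have "Y.covered_by W"
      unfolding Y.covered_by_def
    proof (intro ballI allI)
      fix z i j assume "z \<in> Y"
      then obtain x' where x': "x' \<in> X" "z = g \<circ> x'" by (auto simp: Y_def)
      obtain ws where ws: "ws \<in> lists (level_words n)" "sublist (map x' [i..j]) (concat ws)"
        using level_words_cover[OF x'(1)] by blast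
      have "sublist (map z [i..j]) (concat (map (map g) ws))"
        using sublist_map[OF ws(2)] by (simp add: x'(2) map_concat)
      moreover have "map (map g) ws \<in> lists W" using ws(1) by (auto simp: W_def)
      ultimately show "\<exists>ws\<in>lists W. sublist (map z [i..j]) (concat ws)" by blast
    qed
    ultimately show "\<exists>W. finite W \<and> card W \<le> K \<and> [] \<notin> W \<and>
        (\<forall>w\<in>W. sublist (map y [- int m..int m]) w) \<and> Y.covered_by W"
      using fin by (intro exI[of _ W]) (simp add: W_def)
  qed
  with Y show ?thesis by blast
qed

end
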